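(* Let $s\in(1/2,1)$ and let $\psi$ be an approximating function. Then for any non-degenerate rational quadric $\mathcal{Q}\subset\mathbb{R}^2$, $$\mathcal{H}^s\big(\mathcal{Q}\cap\mathcal{S}_2(\psi)\big)=0\quad\text{if}\quad\sum_{h=1}^\infty h^{1-s}\,\psi(h)^{s+1}<\infty.$$
   Context: An approximating function is a decreasing function $\psi:\mathbb{R}^+\to\mathbb{R}^+$. For $x\in\mathbb{R}$, $\|x\|=\min\{|x-m|:m\in\mathbb{Z}\}$. $\mathcal{S}_2(\psi)$ is the set of $(y_1,y_2)\in\mathbb{R}^2$ for which there are infinitely many $q\in\mathbb{N}$ with $\max(\|qy_1\|,\|qy_2\|)<\psi(q)$. A non-degenerate rational quadric is the image, under a rational affine transformation of the plane (an invertible affine map with rational coefficients), of one of: the unit circle $\{x_1^2+x_2^2=1\}$, the hyperbola $\{x_1^2-x_2^2=1\}$, or the parabola $\{x_2=x_1^2\}$. $\mathcal{H}^s$ is $s$-dimensional Hausdorff measure. *)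

theory Defs
  imports "HOL-Analysis.Analysis"
begin

text \<open>
  Hausdorff measure in a metric space, as a set function with values in \<open>[0, \<infinity>]\<close>, for \<open>s > 0\<close>.
  Covers are sequences of arbitrary sets; finite covers are included by padding with the empty
  set, which contributes \<open>0 powr s = 0\<close>. Boundedness is required explicitly because
  \<^const>\<open>diameter\<close> is real-valued and unspecified on unbounded sets. The infimum over
  the empty family of covers is \<open>\<infinity>\<close>.
\<close>

definition hausdorff_premeasure :: "real \<Rightarrow> real \<Rightarrow> 'a::metric_space set \<Rightarrow> ennreal" where
  "hausdorff_premeasure s \<delta> A =
     (INF U \<in> {U :: nat \<Rightarrow> 'a set. A \<subseteq> (\<Union>i. U i) \<and> (\<forall>i. bounded (U i) \<and> diameter (U i) \<le> \<delta>)}.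
        \<Sum>i. ennreal (diameter (U i) powr s))"

definition hausdorff_measure :: "real \<Rightarrow> 'a::metric_space set \<Rightarrow> ennreal" where
  "hausdorff_measure s A = (SUP \<delta> \<in> {0<..}. hausdorff_premeasure s \<delta> A)"

text \<open>
  The positive half-line is the open one, and decreasing means non-increasing. Values of the
  function outside the half-line are irrelevant.
\<close>

definition approximating_function :: "(real \<Rightarrow> real) \<Rightarrow> bool" where
  "approximating_function \<psi> \<longleftrightarrow> \<psi> \<in> {0<..} \<rightarrow> {0<..} \<and> antimono_on {0<..} \<psi>"

abbreviation int_dist :: "real \<Rightarrow> real" where
  "int_dist x \<equiv> infdist x \<int>"

text \<open>The infimum over the integers is a minimum:\<close>

lemma int_dist_attained: "\<exists>m::int. int_dist x = \<bar>x - of_int m\<bar>"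
proof -
  have "(\<int> :: real set) \<noteq> {}"
    using Ints_0 by blast
  then obtain y :: real where "y \<in> \<int>" "infdist x \<int> = dist x y"
    using infdist_attains_inf[OF closed_Ints] by blast
  then show ?thesis
    by (auto simp: dist_real_def elim!: Ints_cases)
qed

lemma int_dist_le: "int_dist x \<le> \<bar>x - of_int m\<bar>"
  using infdist_le[of "of_int m" "\<int>" x] by (simp add: dist_real_def)

definition simult_approx :: "(real \<Rightarrow> real) \<Rightarrow> (real ^ 2) set" where
  "simult_approx \<psi> =
     {y. infinite {q::nat. 1 \<le> q \<and>
        max (int_dist (real q * y $ 1)) (int_dist (real q * y $ 2)) < \<psi> (real q)}}"

definition rational_affine :: "(real ^ 2 \<Rightarrow> real ^ 2) \<Rightarrow> bool" where
  "rational_affine T \<longleftrightarrow>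
     (\<exists>(A :: real ^ 2 ^ 2) (b :: real ^ 2).
        (\<forall>i j. A $ i $ j \<in> \<rat>) \<and> (\<forall>i. b $ i \<in> \<rat>) \<and> invertible A \<and> T = (\<lambda>x. A *v x + b))"

definition unit_circle :: "(real ^ 2) set" where
  "unit_circle = {x. (x $ 1)\<^sup>2 + (x $ 2)\<^sup>2 = 1}"

definition unit_hyperbola :: "(real ^ 2) set" where
  "unit_hyperbola = {x. (x $ 1)\<^sup>2 - (x $ 2)\<^sup>2 = 1}"

definition unit_parabola :: "(real ^ 2) set" where
  "unit_parabola = {x. x $ 2 = (x $ 1)\<^sup>2}"

definition nondegenerate_rational_quadric :: "(real ^ 2) set \<Rightarrow> bool" where
  "nondegenerate_rational_quadric Q \<longleftrightarrow>
     (\<exists>T. rational_affine T \<and> (\<exists>C \<in> {unit_circle, unit_hyperbola, unit_parabola}. Q = T ` C))"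

end

theory Submission
  imports Defs "HOL-Real_Asymp.Real_Asymp"
begin

text \<open>
  A parametrisation by a rational coordinate \<open>x\<close> turns each conic into the parabola
  \<open>{(x, x\<^sup>2)}\<close>: there are integral affine forms \<open>G\<^sub>0, G\<^sub>1, G\<^sub>2\<close> on the plane whose values on the
  conic are in the ratio \<open>1 : x : x\<^sup>2\<close>. On the parabola, a good approximation with denominator
  \<open>q\<close> of size \<open>Q\<close> and error \<open>\<delta>\<close> gives integers with \<open>|qr - p\<^sup>2| \<le> N\<close>, where \<open>N\<close> is of order
  \<open>\<delta>Q\<close>, and one has to show that there are only \<open>O(NQ)\<close> such triples. By Dirichlet,
  \<open>p/q\<close> is close to a fraction \<open>d/c\<close> with \<open>c \<le> Q\<^sup>1\<^sup>/\<^sup>2 N\<^sup>-\<^sup>1\<^sup>/\<^sup>4\<close>; the value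
  \<open>L = c\<^sup>2r - 2cdp + d\<^sup>2q\<close> of the form with nearly vanishing discriminant is then \<open>O(N\<^sup>1\<^sup>/\<^sup>2)\<close>, and
  \<open>qL = (cp - dq)\<^sup>2 + c\<^sup>2(qr - p\<^sup>2)\<close> confines \<open>cp - dq\<close> to a short interval in a class modulo \<open>c\<close>, and
  then \<open>q\<close> to a short interval in a class modulo \<open>c\<^sup>2\<close>. Summing over \<open>L\<close>, \<open>d\<close>, \<open>c\<close> gives
  \<open>O(NQ + N\<^sup>1\<^sup>/\<^sup>2 Q log Q)\<close>. Since \<open>s > 1/2\<close>, the error function may be assumed to be at least
  \<open>q\<^sup>-\<^sup>\<tau>\<close> with \<open>\<tau> < 1\<close>, so that the logarithm is absorbed. The dyadic covers then have
  \<open>s\<close>-content \<open>O(\<delta>Q\<^sup>2(\<delta>/Q)\<^sup>s)\<close>, the general term of the condensed series.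
\<close>

section \<open>Hausdorff content and its null sets\<close>

text \<open>This is the premeasure with no bound on the diameters. For positive \<open>s\<close>,
  content 0 forces measure 0, so the limit over small scales stays out of the estimates.\<close>

definition hausdorff_content :: "real \<Rightarrow> 'a::metric_space set \<Rightarrow> ennreal" where
  "hausdorff_content s A =
     (INF U \<in> {U :: nat \<Rightarrow> 'a set. A \<subseteq> (\<Union>i. U i) \<and> (\<forall>i. bounded (U i))}.
        \<Sum>i. ennreal (diameter (U i) powr s))"

lemma hausdorff_content_le:
  assumes "A \<subseteq> (\<Union>i. U i)" "\<And>i. bounded (U i)"
  shows "hausdorff_content s A \<le> (\<Sum>i. ennreal (diameter (U i) powr s))"
  unfolding hausdorff_content_def using assms by (intro INF_lower) auto

lemma hausdorff_content_close:
  assumes "hausdorff_content s A < b"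
  shows "\<exists>U. A \<subseteq> (\<Union>i. U i) \<and> (\<forall>i. bounded (U i)) \<and>
    (\<Sum>i. ennreal (diameter (U i) powr s)) < b"
  using assms unfolding hausdorff_content_def INF_less_iff by auto

lemma hausdorff_content_mono:
  "A \<subseteq> B \<Longrightarrow> hausdorff_content s A \<le> hausdorff_content s B"
  unfolding hausdorff_content_def by (intro INF_superset_mono) auto

lemma hausdorff_content_le_diameter:
  assumes "bounded A"
  shows "hausdorff_content s A \<le> ennreal (diameter A powr s)"
proof -
  have "hausdorff_content s A \<le> (\<Sum>i. ennreal (diameter (if i = (0::nat) then A else {}) powr s))"
    using assms by (intro hausdorff_content_le) auto
  also have "\<dots> = (\<Sum>i\<in>{0}. ennreal (diameter (if i = (0::nat) then A else {}) powr s))"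
    by (intro suminf_finite) auto
  finally show ?thesis by simp
qed

text \<open>Each \<open>A n\<close> gets a cover that is optimal up to \<open>e / 2 ^ Suc n\<close>,
  and \<open>prod_decode\<close> lists the double family of covering sets as one sequence.\<close>

lemma hausdorff_content_countable_subadditive:
  "hausdorff_content s (\<Union>i. A i) \<le> (\<Sum>n. hausdorff_content s (A n))"
proof (rule ennreal_le_epsilon)
  fix e :: real assume e: "0 < e" and "(\<Sum>n. hausdorff_content s (A n)) < top"
  \<comment> \<open>Finiteness of the whole sum makes every single content finite, hence strictly
    below its perturbation.\<close>
  then have "hausdorff_content s (A n) < hausdorff_content s (A n) + e * (1/2)^Suc n" for n
    by (auto simp add: less_top dest!: ennreal_suminf_lessD)
  from hausdorff_content_close[OF this]
  have "\<exists>U. A n \<subseteq> (\<Union>i. U i) \<and> (\<forall>i. bounded (U i)) \<and>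
      (\<Sum>i. ennreal (diameter (U i) powr s)) \<le> hausdorff_content s (A n) + e * (1/2)^Suc n" for n
    by (meson less_imp_le)
  then obtain B where B: "\<And>n. A n \<subseteq> (\<Union>i. B n i)" "\<And>n i. bounded (B n i)"
    "\<And>n. (\<Sum>i. ennreal (diameter (B n i) powr s)) \<le> hausdorff_content s (A n) + e * (1/2)^Suc n"
    by metis
  define C where "C = case_prod B \<circ> prod_decode"
  have "(\<Union>i. A i) \<subseteq> (\<Union>i. C i)"
    using B(1) by (auto simp add: C_def subset_eq) (metis prod.case prod_encode_inverse)
  then have "hausdorff_content s (\<Union>i. A i) \<le> (\<Sum>i. ennreal (diameter (C i) powr s))"
    using B(2) by (intro hausdorff_content_le) (auto simp: C_def split: prod.split)
  also have "\<dots> = (\<Sum>i. (\<lambda>(n, i). ennreal (diameter (B n i) powr s)) (prod_decode i))"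
    by (simp add: C_def split_def)
  also have "\<dots> = (\<Sum>n. \<Sum>i. ennreal (diameter (B n i) powr s))"
    by (intro suminf_ennreal_2dimen) auto
  also have "\<dots> \<le> (\<Sum>n. hausdorff_content s (A n) + e * (1/2) ^ Suc n)"
    by (intro suminf_le allI B) auto
  also have "\<dots> = (\<Sum>n. hausdorff_content s (A n)) + (\<Sum>n. ennreal e * ennreal ((1/2) ^ Suc n))"
    using e by (subst suminf_add[symmetric])
      (auto simp del: ennreal_suminf_cmult simp add: ennreal_mult[symmetric])
  also have "\<dots> = (\<Sum>n. hausdorff_content s (A n)) + e"
    unfolding ennreal_suminf_cmult
    by (subst suminf_ennreal_eq[OF zero_le_power power_half_series]) auto
  finally show "hausdorff_content s (\<Union>i. A i) \<le> (\<Sum>n. hausdorff_content s (A n)) + e" .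
qed

lemma hausdorff_content_countable_UN_eq_0:
  fixes A :: "nat \<Rightarrow> 'a::metric_space set"
  assumes "\<And>i. hausdorff_content s (A i) = 0"
  shows "hausdorff_content s (\<Union>i. A i) = 0"
  using hausdorff_content_countable_subadditive[of s A] assms by simp

lemma hausdorff_content_finite_UN_le:
  assumes "finite I"
  shows "hausdorff_content s (\<Union>i\<in>I. A i) \<le> (\<Sum>i\<in>I. hausdorff_content s (A i))"
proof -
  obtain f where f: "bij_betw f {..<card I} I"
    using ex_bij_betw_nat_finite[OF assms] by (auto simp: lessThan_atLeast0)
  define B where "B n = (if n < card I then A (f n) else {})" for n
  have e: "hausdorff_content s ({}::'b set) = 0"
    using hausdorff_content_le_diameter[of "{}::'b set" s] by simp
  have "(\<Union>i\<in>f ` {..<card I}. A i) = (\<Union>n. B n)"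
    by (auto simp: B_def split: if_splits)
  then have "(\<Union>i\<in>I. A i) = (\<Union>n. B n)"
    by (simp add: bij_betw_imp_surj_on[OF f])
  also have "hausdorff_content s \<dots> \<le> (\<Sum>n. hausdorff_content s (B n))"
    by (rule hausdorff_content_countable_subadditive)
  also have "\<dots> = (\<Sum>n<card I. hausdorff_content s (B n))"
    by (intro suminf_finite) (auto simp: B_def e)
  also have "\<dots> = (\<Sum>n<card I. hausdorff_content s (A (f n)))"
    by (intro sum.cong) (auto simp: B_def)
  also have "\<dots> = (\<Sum>i\<in>I. hausdorff_content s (A i))"
    by (rule sum.reindex_bij_betw[OF f])
  finally show ?thesis .
qed

lemma hausdorff_content_Un_eq_0:
  assumes "hausdorff_content s A = 0" "hausdorff_content s B = 0"
  shows "hausdorff_content s (A \<union> B) = 0"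
  using hausdorff_content_finite_UN_le[of "{True, False}" s "\<lambda>b. if b then A else B"] assms
  by (simp add: Un_commute)

lemma diameter_lipschitz_image_le:
  fixes f :: "'a::metric_space \<Rightarrow> 'b::metric_space"
  assumes "L-lipschitz_on X f" "bounded X"
  shows "diameter (f ` X) \<le> L * diameter X"
proof (cases "X = {}")
  case False
  have "dist (f x) (f y) \<le> L * diameter X" if "x \<in> X" "y \<in> X" for x y
    using lipschitz_onD[OF assms(1) that] diameter_bounded_bound[OF assms(2) that]
      lipschitz_on_nonneg[OF assms(1)] by (meson mult_left_mono order_trans)
  then show ?thesis
    using False unfolding diameter_def by (auto intro!: cSUP_least)
qed (use assms in auto)

text \<open>The covering sets are cut down to \<open>A\<close> before they are mapped, because the
  Lipschitz bound holds only there. The total of the \<open>s\<close>-th powers then grows by at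
  most the factor \<open>L powr s\<close>.\<close>

lemma hausdorff_content_lipschitz_eq_0:
  fixes f :: "'a::metric_space \<Rightarrow> 'b::metric_space"
  assumes "L-lipschitz_on A f" "hausdorff_content s A = 0" "0 < s"
  shows "hausdorff_content s (f ` A) = 0"
proof -
  have L: "0 \<le> L" using lipschitz_on_nonneg[OF assms(1)] .
  have "hausdorff_content s (f ` A) \<le> ennreal (L powr s) * b" if "0 < b" for b
  proof -
    have "hausdorff_content s A < b" using assms(2) that by simp
    then obtain U where U: "A \<subseteq> (\<Union>i. U i)" "\<And>i. bounded (U i)"
        "(\<Sum>i. ennreal (diameter (U i) powr s)) < b"
      using hausdorff_content_close by blast
    define V where "V i = f ` (A \<inter> U i)" for i
    have lip: "L-lipschitz_on (A \<inter> U i) f" for i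
      using assms(1) by (rule lipschitz_on_subset) auto
    have bd: "bounded (A \<inter> U i)" for i using U(2) by (meson bounded_Int)
    have bV: "bounded (V i)" for i
      unfolding V_def bounded_two_points
      using diameter_bounded_bound[OF bd] lipschitz_onD[OF lip] L
      by (intro exI[of _ "L * diameter (A \<inter> U i)"])
        (force intro: order.trans[OF _ mult_left_mono])
    have dV: "diameter (V i) powr s \<le> L powr s * diameter (U i) powr s" for i
    proof -
      have "diameter (V i) \<le> L * diameter (A \<inter> U i)"
        unfolding V_def by (intro diameter_lipschitz_image_le lip bd)
      also have "\<dots> \<le> L * diameter (U i)"
        using L U(2) by (intro mult_left_mono diameter_subset) auto
      finally have "diameter (V i) powr s \<le> (L * diameter (U i)) powr s"
        using diameter_ge_0[OF bV] assms(3) by (intro powr_mono2) auto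
      then show ?thesis
        using L diameter_ge_0[OF U(2)] by (simp add: powr_mult)
    qed
    have "f ` A \<subseteq> (\<Union>i. V i)" using U(1) unfolding V_def by blast
    then have "hausdorff_content s (f ` A) \<le> (\<Sum>i. ennreal (diameter (V i) powr s))"
      using bV by (rule hausdorff_content_le)
    also have "\<dots> \<le> (\<Sum>i. ennreal (L powr s) * ennreal (diameter (U i) powr s))"
      by (intro suminf_le allI) (auto simp: ennreal_mult[symmetric] intro!: ennreal_leI dV)
    also have "\<dots> = ennreal (L powr s) * (\<Sum>i. ennreal (diameter (U i) powr s))"
      by simp
    also have "\<dots> \<le> ennreal (L powr s) * b"
      using U(3) by (intro mult_left_mono) auto
    finally show ?thesis .
  qed
  note bnd = this
  have "hausdorff_content s (f ` A) \<le> 0"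
  proof (rule ennreal_le_epsilon)
    fix e :: real assume that: "0 < e"
    \<comment> \<open>The summand 1 in the denominator covers the case \<open>L = 0\<close>.\<close>
    have "hausdorff_content s (f ` A) \<le> ennreal (L powr s) * ennreal (e / (L powr s + 1))"
      using that by (intro bnd) (simp add: add_nonneg_pos)
    also have "\<dots> = ennreal (L powr s * (e / (L powr s + 1)))"
      using that by (subst ennreal_mult) (auto intro!: divide_nonneg_nonneg)
    also have "\<dots> \<le> ennreal e"
    proof (rule ennreal_leI)
      have "0 < L powr s + 1" by (simp add: add_nonneg_pos)
      then show "L powr s * (e / (L powr s + 1)) \<le> e" using that by (simp add: field_simps)
    qed
    finally show "hausdorff_content s (f ` A) \<le> 0 + ennreal e" by simp
  qed
  then show ?thesis by simp
qed

text \<open>A cover whose diameters have small \<open>s\<close>-th powers in sum automatically consists of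
  small sets, so the bound on the diameters is redundant for null sets.\<close>

lemma hausdorff_measure_eq_0:
  fixes A :: "'a::metric_space set"
  assumes "hausdorff_content s A = 0" "0 < s"
  shows "hausdorff_measure s A = 0"
proof -
  have "hausdorff_premeasure s \<delta> A \<le> 0" if \<delta>: "0 < \<delta>" for \<delta>
  proof (rule ennreal_le_epsilon)
    fix e :: real assume e: "0 < e"
    have "hausdorff_content s A < ennreal (min e (\<delta> powr s))" using e \<delta> assms by simp
    then obtain U where U: "A \<subseteq> (\<Union>i. U i)" "\<And>i. bounded (U i)"
        "(\<Sum>i. ennreal (diameter (U i) powr s)) < ennreal (min e (\<delta> powr s))"
      using hausdorff_content_close by blast
    have "diameter (U i) \<le> \<delta>" for i
    proof (rule ccontr)
      assume "\<not> ?thesis"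
      then have "\<delta> powr s \<le> diameter (U i) powr s" using \<delta> assms by (intro powr_mono2) auto
      then have "ennreal (\<delta> powr s) \<le> ennreal (diameter (U i) powr s)" by (rule ennreal_leI)
      also have "\<dots> \<le> (\<Sum>i. ennreal (diameter (U i) powr s))"
        by (rule sum_le_suminf[OF summableI, of "{i}", simplified])
      also have "\<dots> < ennreal (\<delta> powr s)"
        by (rule less_le_trans[OF U(3)]) (intro ennreal_leI, simp)
      finally show False by simp
    qed
    then have "hausdorff_premeasure s \<delta> A \<le> (\<Sum>i. ennreal (diameter (U i) powr s))"
      unfolding hausdorff_premeasure_def using U by (intro INF_lower) auto
    also have "\<dots> \<le> ennreal e"
      by (rule order.trans[OF less_imp_le[OF U(3)]]) (intro ennreal_leI, simp)
    finally show "hausdorff_premeasure s \<delta> A \<le> 0 + ennreal e" by simp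
  qed
  then have "hausdorff_measure s A \<le> 0"
    unfolding hausdorff_measure_def by (intro SUP_least) simp
  then show ?thesis by simp
qed

section \<open>Counting in residue classes and along fibres; two partial sums\<close>

text \<open>Measured from the least element, the points are multiples of \<open>m\<close> between 0
  and \<open>b - a\<close>. Nonemptiness gives \<open>a \<le> b\<close>; for an empty set the
  right-hand side could be negative.\<close>

lemma card_congruent_in_interval_le:
  fixes A :: "int set" and m :: int and a b :: real
  assumes "0 < m" "A \<noteq> {}" "\<And>x. x \<in> A \<Longrightarrow> a \<le> of_int x \<and> of_int x \<le> b"
    and cong: "\<And>x y. x \<in> A \<Longrightarrow> y \<in> A \<Longrightarrow> m dvd x - y"
  shows "finite A" "real (card A) \<le> (b - a) / m + 1"
proof -
  have sub: "A \<subseteq> {\<lceil>a\<rceil>..\<lfloor>b\<rfloor>}"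
    using assms(3) by (auto simp: ceiling_le_iff le_floor_iff)
  then show fin: "finite A" using finite_subset by blast
  define x0 where "x0 = Min A"
  have x0: "x0 \<in> A" "\<And>x. x \<in> A \<Longrightarrow> x0 \<le> x" using fin assms(2) by (auto simp: x0_def)
  define f where "f x = (x - x0) div m" for x
  have fm: "f x * m = x - x0" if "x \<in> A" for x
    using cong[OF that x0(1)] by (simp add: f_def)
  have "inj_on f A" by (metis fm inj_onI diff_add_cancel)
  moreover have "f ` A \<subseteq> {0..\<lfloor>(b - a) / m\<rfloor>}"
  proof clarify
    fix x assume x: "x \<in> A"
    have "0 \<le> f x" using x0(2)[OF x] assms(1) by (simp add: f_def pos_imp_zdiv_nonneg_iff)
    moreover have "real_of_int (f x) * m \<le> b - a"
      using assms(3)[OF x] assms(3)[OF x0(1)] by (simp flip: of_int_mult add: fm[OF x])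
    then have "real_of_int (f x) \<le> (b - a) / m" using assms(1) by (simp add: field_simps)
    ultimately show "f x \<in> {0..\<lfloor>(b - a) / m\<rfloor>}" by (simp add: le_floor_iff)
  qed
  ultimately have "card A \<le> card {0..\<lfloor>(b - a) / m\<rfloor>}"
    by (metis card_image card_mono finite_atLeastAtMost_int)
  also have "\<dots> = nat (\<lfloor>(b - a) / m\<rfloor> + 1)" by simp
  finally have "card A \<le> nat (\<lfloor>(b - a) / m\<rfloor> + 1)" .
  moreover have "a \<le> b" using assms(3)[OF x0(1)] by linarith
  then have "0 \<le> \<lfloor>(b - a) / m\<rfloor>" using assms(1) by simp
  ultimately have "real (card A) \<le> of_int \<lfloor>(b - a) / m\<rfloor> + 1"
    by linarith
  then show "real (card A) \<le> (b - a) / m + 1" by linarith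
qed

lemma card_le_card_image_times_fibre:
  assumes "finite S" "real (card (f ` S)) \<le> k" "0 \<le> n"
    and "\<And>y. y \<in> f ` S \<Longrightarrow> real (card {x \<in> S. f x = y}) \<le> n"
  shows "real (card S) \<le> k * n"
proof -
  have "card S = (\<Sum>y\<in>f ` S. card {x \<in> S. f x = y})"
    using sum.image_gen[OF assms(1), of "\<lambda>_. 1::nat" f] by simp
  then have "real (card S) = (\<Sum>y\<in>f ` S. real (card {x \<in> S. f x = y}))"
    by (simp flip: of_nat_sum)
  also have "\<dots> \<le> (\<Sum>y\<in>f ` S. n)" by (intro sum_mono assms(4))
  also have "\<dots> = card (f ` S) * n" by simp
  also have "\<dots> \<le> k * n" using assms(2,3) by (rule mult_right_mono)
  finally show ?thesis .
qed

lemma sum_inverse_le_ln: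
  assumes "1 \<le> n"
  shows "(\<Sum>c=1..n. 1 / real c) \<le> 1 + ln (real n)"
  using assms
proof (induction n rule: dec_induct)
  case (step n)
  have "1 / real (Suc n) \<le> ln (real (Suc n)) - ln (real n)"
  proof -
    have "ln (real n / real (Suc n)) \<le> real n / real (Suc n) - 1"
      using step by (intro ln_le_minus_one) auto
    then show ?thesis using step by (simp add: ln_div field_simps)
  qed
  with step show ?case by simp
qed simp

text \<open>Rationalising \<open>sqrt (n + 1) - sqrt n\<close> bounds each term by a telescoping
  difference.\<close>

lemma sum_inverse_sqrt_le: "(\<Sum>l=1..n. 1 / sqrt (real l)) \<le> 2 * sqrt (real n)"
proof (induction n)
  case (Suc n)
  have "1 / sqrt (real (Suc n)) \<le> 2 * (sqrt (real (Suc n)) - sqrt (real n))"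
  proof -
    have "(sqrt (real (Suc n)) - sqrt (real n)) * (sqrt (real (Suc n)) + sqrt (real n)) = 1"
      by (simp add: algebra_simps)
    moreover have "sqrt (real n) \<le> sqrt (real (Suc n))" by simp
    ultimately have "1 \<le> (sqrt (real (Suc n)) - sqrt (real n)) * (2 * sqrt (real (Suc n)))"
      by (metis (no_types, lifting) add_left_mono add.commute diff_ge_0_iff_ge mult_2 mult_left_mono)
    then show ?thesis by (simp add: field_simps)
  qed
  then show ?case using Suc by simp
qed simp

text \<open>The quantity \<open>L\<close> below is the value at \<open>(c, -d)\<close> of the binary quadratic form with
  coefficients \<open>(r, 2p, q)\<close>, and \<open>w\<close> is half a partial derivative there; completing the square gives
  this identity.\<close>

lemma form_value_identity:
  fixes q p r c d :: "'a::comm_ring_1"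
  shows "q * (c\<^sup>2 * r - 2 * c * d * p + d\<^sup>2 * q) = (c * p - d * q)\<^sup>2 + c\<^sup>2 * (q * r - p\<^sup>2)"
  by (simp add: algebra_simps power2_eq_square)

section \<open>Integer triples near the cone \<open>q * r = p\<^sup>2\<close>\<close>

text \<open>For fixed \<open>c\<close>, \<open>d\<close>, \<open>L\<close> a triple is determined by
  \<open>w = c * p - d * q\<close> together with \<open>q\<close>. The values of \<open>w\<close>
  lie in one class modulo \<open>c\<close> inside a bounded interval; for fixed \<open>w\<close> the
  values of \<open>q\<close> lie in one class modulo \<open>c\<^sup>2\<close>, and if
  \<open>L \<noteq> 0\<close> also close to \<open>w\<^sup>2 / L\<close>. The two counts are
  multiplied.\<close>

lemma card_triples_fixed_form_value_le:
  fixes S :: "(int \<times> int \<times> int) set" and c d L :: int and Q N :: real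
  assumes fin: "finite S" and cd: "coprime c d" and c: "0 < c" and Q: "of_int c ^ 2 \<le> Q"
    and N: "1 \<le> N" and L: "\<bar>L\<bar> \<le> 17 * sqrt N"
    and S: "\<And>q p r. (q, p, r) \<in> S \<Longrightarrow> Q \<le> q \<and> q < 2 * Q \<and> \<bar>q * r - p\<^sup>2\<bar> \<le> N \<and>
              c\<^sup>2 * r - 2 * c * d * p + d\<^sup>2 * q = L"
  shows "L \<noteq> 0 \<Longrightarrow> real (card S) \<le> 90 * N * sqrt Q / (c * sqrt \<bar>L\<bar>)"
    and "L = 0 \<Longrightarrow> real (card S) \<le> 6 * sqrt N * Q / (real_of_int c)\<^sup>2"
proof -
  define w :: "int \<times> int \<times> int \<Rightarrow> int" where "w = (\<lambda>(q, p, r). c * p - d * q)"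
  \<comment> \<open>By the identity for \<open>q * L\<close> and \<open>q < 2 * Q\<close>, the
    square of \<open>w\<close> is at most the radicand.\<close>
  define B where "B = sqrt (2 * Q * \<bar>L\<bar> + (real_of_int c)\<^sup>2 * N)"
  have c1: "1 \<le> real_of_int c" using c by simp
  then have c2: "1 \<le> real_of_int c ^ 2" by (rule one_le_power)
  then have Q1: "1 \<le> Q" using Q by linarith
  have ident: "\<bar>real_of_int q * real_of_int L - (real_of_int (w (q, p, r)))\<^sup>2\<bar> \<le> (real_of_int c)\<^sup>2 * N"
    if "(q, p, r) \<in> S" for q p r
  proof -
    have "q * L - (w (q, p, r))\<^sup>2 = c\<^sup>2 * (q * r - p\<^sup>2)"
      using form_value_identity[of q c r d p] S[OF that] by (simp add: w_def)
    from arg_cong[OF this, of real_of_int]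
    have "real_of_int q * real_of_int L - (real_of_int (w (q, p, r)))\<^sup>2
        = (real_of_int c)\<^sup>2 * real_of_int (q * r - p\<^sup>2)" by simp
    moreover have "\<bar>real_of_int (q * r - p\<^sup>2)\<bar> \<le> N" using S[OF that] by simp
    ultimately show ?thesis by (simp only: abs_mult) (simp add: mult_left_mono)
  qed
  have card_w: "real (card (w ` S)) \<le> 2 * B / c + 1" if ne: "S \<noteq> {}"
  proof -
    have "real (card (w ` S)) \<le> (B - (- B)) / c + 1"
    proof (rule card_congruent_in_interval_le(2)[OF c])
      fix x assume "x \<in> w ` S"
      then obtain q p r where t: "(q, p, r) \<in> S" "x = w (q, p, r)" by auto
      have "real_of_int q * L \<le> real_of_int q * \<bar>L\<bar>"
        using S[OF t(1)] Q1 by (intro mult_left_mono) auto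
      also have "\<dots> \<le> 2 * Q * \<bar>L\<bar>" using S[OF t(1)] by (intro mult_right_mono) auto
      finally have "(of_int x)\<^sup>2 \<le> 2 * Q * \<bar>L\<bar> + (real_of_int c)\<^sup>2 * N"
        using ident[OF t(1)] unfolding t(2) by linarith
      then have "\<bar>real_of_int x\<bar> \<le> B"
        unfolding B_def by (metis real_sqrt_abs real_sqrt_le_iff)
      then show "- B \<le> of_int x \<and> of_int x \<le> B" by linarith
    next
      \<comment> \<open>As \<open>d\<close> is invertible modulo \<open>c\<close>, this fixes the
        class of \<open>w\<close> modulo \<open>c\<close>.\<close>
      have *: "c dvd L + d * w t" if "t \<in> S" for t
      proof -
        obtain q p r where t: "t = (q, p, r)" by (cases t) auto
        have "L + d * w t = c * (c * r - d * p)"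
          using S[of q p r] that unfolding t w_def by (auto simp: algebra_simps power2_eq_square)
        then show ?thesis by simp
      qed
      fix x y assume "x \<in> w ` S" "y \<in> w ` S"
      then have "c dvd L + d * x" "c dvd L + d * y" using * by auto
      then have "c dvd (L + d * x) - (L + d * y)" by (rule dvd_diff)
      also have "\<dots> = d * (x - y)" by (simp add: algebra_simps)
      finally show "c dvd x - y" using cd by (simp add: coprime_dvd_mult_right_iff)
    qed (use ne in auto)
    then show ?thesis by simp
  qed
  have fibre: "real (card {t \<in> S. w t = y}) \<le> Q / (real_of_int c)\<^sup>2 + 1 \<and>
      (L \<noteq> 0 \<longrightarrow> real (card {t \<in> S. w t = y}) \<le> 2 * N / \<bar>L\<bar> + 1)" if y: "y \<in> w ` S" for y
  proof -
    define F where "F = {t \<in> S. w t = y}"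
    have Fne: "fst ` F \<noteq> {}" using y by (auto simp: F_def)
    \<comment> \<open>With \<open>w\<close> fixed, these two equations recover \<open>p\<close> and
      \<open>r\<close> from \<open>q\<close>, and their differences yield the congruence for
      \<open>q\<close>.\<close>
    have mem: "c * p = y + d * q \<and> c * (c * r) = L + d * (2 * y + d * q)"
      if "(q, p, r) \<in> F" for q p r
    proof -
      have 1: "c * p = y + d * q" using that by (auto simp: F_def w_def)
      have "c * (c * r) = L + 2 * d * (c * p) - d\<^sup>2 * q"
        using that S[of q p r] by (auto simp: F_def algebra_simps power2_eq_square)
      then show ?thesis unfolding 1 by (auto simp: 1 algebra_simps power2_eq_square)
    qed
    have inj: "inj_on fst F"
    proof (rule inj_onI)
      fix s t assume st: "s \<in> F" "t \<in> F" "fst s = fst t"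
      obtain q p r p' r' where e: "s = (q, p, r)" "t = (q, p', r')"
        using st by (metis prod.collapse)
      have "c * p = c * p'" "c * (c * r) = c * (c * r')"
        using mem st(1,2) unfolding e by metis+
      then show "s = t" using c by (simp add: e)
    qed
    \<comment> \<open>The first equation gives \<open>x - x' = c * k\<close>. Inserted into the
      difference of the second equations, after cancelling \<open>c\<close>, this gives
      \<open>c dvd d * (d * k)\<close>, hence \<open>c dvd k\<close>.\<close>
    have dvd: "c\<^sup>2 dvd x - x'" if "x \<in> fst ` F" "x' \<in> fst ` F" for x x'
    proof -
      from that obtain t t' where t: "t \<in> F" "x = fst t" "t' \<in> F" "x' = fst t'" by blast
      obtain p r where "t = (x, p, r)" using t(2) by (cases t) auto
      moreover obtain p' r' where "t' = (x', p', r')" using t(4) by (cases t') auto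
      ultimately have t: "(x, p, r) \<in> F" "(x', p', r') \<in> F" using t by auto
      have "c * (p - p') = d * (x - x')"
        using mem[OF t(1)] mem[OF t(2)] by (simp add: algebra_simps)
      then have "c dvd d * (x - x')" by (metis dvd_triv_left)
      then have "c dvd x - x'" using cd by (simp add: coprime_dvd_mult_right_iff)
      then obtain k where k: "x - x' = c * k" by blast
      have "c * (c * (r - r')) = d * (d * (x - x'))"
        using mem[OF t(1)] mem[OF t(2)] by (simp add: algebra_simps)
      then have "c * (c * (r - r')) = c * (d * (d * k))" unfolding k by (simp add: algebra_simps)
      then have "c * (r - r') = d * (d * k)" using c by simp
      then have "c dvd d * (d * k)" by (metis dvd_triv_left)
      then have "c dvd k" using cd by (simp add: coprime_dvd_mult_right_iff)
      then show ?thesis unfolding k by (auto simp: power2_eq_square)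
    qed
    have card: "card F = card (fst ` F)" using inj by (simp add: card_image)
    have c2pos: "0 < c\<^sup>2" using c by simp
    have "real (card (fst ` F)) \<le> (2 * Q - Q) / (c\<^sup>2) + 1"
    proof (rule card_congruent_in_interval_le(2)[OF c2pos Fne _ dvd])
      fix x assume "x \<in> fst ` F"
      then show "Q \<le> of_int x \<and> of_int x \<le> 2 * Q" using S by (force simp: F_def)
    qed auto
    moreover have "real (card (fst ` F)) \<le> 2 * N / \<bar>L\<bar> + 1" if L0: "L \<noteq> 0"
    proof -
      \<comment> \<open>Dividing the identity by \<open>L\<close> places \<open>q\<close> within
        \<open>v\<close> of \<open>u\<close>; the length \<open>2 * v\<close> over the modulus
        \<open>c\<^sup>2\<close> is \<open>2 * N / \<bar>L\<bar>\<close>.\<close>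
      define u where "u = (of_int y)\<^sup>2 / real_of_int L"
      define v where "v = (real_of_int c)\<^sup>2 * N / \<bar>L\<bar>"
      have "real (card (fst ` F)) \<le> ((u + v) - (u - v)) / (c\<^sup>2) + 1"
      proof (rule card_congruent_in_interval_le(2)[OF c2pos Fne _ dvd])
        fix x assume "x \<in> fst ` F"
        then obtain p r where t: "(x, p, r) \<in> S" "w (x, p, r) = y" by (auto simp: F_def)
        have Lr: "real_of_int L \<noteq> 0" using L0 by simp
        have "\<bar>(real_of_int x - u) * real_of_int L\<bar> = \<bar>real_of_int x * real_of_int L - (real_of_int y)\<^sup>2\<bar>"
          using L0 by (simp add: u_def left_diff_distrib)
        also have "\<dots> \<le> (real_of_int c)\<^sup>2 * N" using ident[OF t(1)] unfolding t(2) by linarith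
        finally have "\<bar>of_int x - u\<bar> * \<bar>real_of_int L\<bar> \<le> (real_of_int c)\<^sup>2 * N" by (simp only: abs_mult)
        then have "\<bar>of_int x - u\<bar> \<le> v" using L0 by (simp add: v_def pos_le_divide_eq)
        then show "u - v \<le> of_int x \<and> of_int x \<le> u + v" by linarith
      qed auto
      also have "((u + v) - (u - v)) / (c\<^sup>2) = 2 * N / \<bar>L\<bar>"
        using c by (simp add: v_def)
      finally show ?thesis .
    qed
    ultimately show ?thesis using card by (simp add: F_def)
  qed
  \<comment> \<open>Since \<open>c\<^sup>2 \<le> Q\<close>, the additive 1 of the residue count is
    absorbed by doubling the main term.\<close>
  have "1 \<le> Q / (real_of_int c)\<^sup>2" using Q c1 by (simp add: field_simps)
  then have fibre1: "real (card {t \<in> S. w t = y}) \<le> 2 * Q / (real_of_int c)\<^sup>2" if "y \<in> w ` S" for y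
    using fibre[OF that] by simp
  have sN: "1 \<le> sqrt N" using N by simp
  have sNN: "sqrt N \<le> N" using N sqrt_le_D[of N N] by (intro real_le_lsqrt) (auto simp: power2_eq_square)
  show "real (card S) \<le> 6 * sqrt N * Q / (real_of_int c)\<^sup>2" if L0: "L = 0"
  proof (cases "S = {}")
    case False
    have "B = c * sqrt N" using L0 c by (simp add: B_def real_sqrt_mult)
    then have "2 * B / c = 2 * sqrt N" using c by simp
    then have "real (card (w ` S)) \<le> 3 * sqrt N" using card_w[OF False] sN by linarith
    then have "real (card S) \<le> 3 * sqrt N * (2 * Q / (real_of_int c)\<^sup>2)"
      using Q1 by (intro card_le_card_image_times_fibre[OF fin _ _ fibre1]) auto
    then show ?thesis by simp
  qed (use N Q1 in auto)
  show "real (card S) \<le> 90 * N * sqrt Q / (c * sqrt \<bar>L\<bar>)" if L0: "L \<noteq> 0"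
  proof (cases "S = {}")
    case False
    have l1: "1 \<le> real_of_int \<bar>L\<bar>" using L0 by linarith
    define l where "l = real_of_int \<bar>L\<bar>"
    define a where "a = 2 * Q / (real_of_int c)\<^sup>2"
    \<comment> \<open>Here 19 is 2 + 17: from \<open>l \<le> 17 * N\<close> the summand 1 in the
      fibre bound is at most \<open>17 * N / l\<close>.\<close>
    define b where "b = 19 * N / l"
    have l: "1 \<le> l" "l \<le> 17 * N" using l1 L sNN by (auto simp: l_def)
    have ab: "0 \<le> a" "0 \<le> b" using Q1 N l by (auto simp: a_def b_def)
    have "1 \<le> 17 * N / l" using l by simp
    then have "2 * N / l + 1 \<le> b" by (simp add: b_def)
    then have fib: "real (card {t \<in> S. w t = y}) \<le> min a b" if "y \<in> w ` S" for y
      using fibre[OF that] fibre1[OF that] L0 by (simp add: a_def l_def)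
    have "B \<le> sqrt (2 * Q * l) + sqrt ((real_of_int c)\<^sup>2 * N)"
      unfolding B_def l_def using Q1 N by (simp add: sqrt_add_le_add_sqrt)
    also have "\<dots> = sqrt 2 * sqrt Q * sqrt l + c * sqrt N"
      using c by (simp add: real_sqrt_mult)
    also have "\<dots> \<le> 3/2 * (sqrt Q * sqrt l) + c * sqrt N"
    proof -
      have "sqrt 2 \<le> (3/2::real)" by (intro real_le_lsqrt) (auto simp: power2_eq_square)
      then have "sqrt 2 * (sqrt Q * sqrt l) \<le> 3/2 * (sqrt Q * sqrt l)"
        using Q1 l by (intro mult_right_mono) auto
      then show ?thesis by (simp add: mult.assoc)
    qed
    finally have "2 * B / c \<le> 2 * (3/2 * (sqrt Q * sqrt l) + c * sqrt N) / c"
      using c by (intro divide_right_mono mult_left_mono) auto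
    also have "\<dots> = 3 * (sqrt Q * sqrt l) / c + 2 * sqrt N" using c by (simp add: field_simps)
    finally have B: "2 * B / c \<le> 3 * (sqrt Q * sqrt l) / c + 2 * sqrt N" .
    have "real_of_int c \<le> sqrt Q" using Q by (rule real_le_rsqrt)
    also have "\<dots> \<le> sqrt Q * sqrt l" using Q1 l by simp
    finally have "1 \<le> sqrt Q * sqrt l / c" using c by simp
    then have "real (card (w ` S)) \<le> 4 * (sqrt Q * sqrt l / c) + 2 * sqrt N"
      using card_w[OF False] B by linarith
    then have "real (card S) \<le> (4 * (sqrt Q * sqrt l / c) + 2 * sqrt N) * min a b"
      using ab by (intro card_le_card_image_times_fibre[OF fin _ _ fib]) auto
    also have "\<dots> = 4 * (sqrt Q * sqrt l / c) * min a b + 2 * sqrt N * min a b"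
      by (rule distrib_right)
    \<comment> \<open>The two parts of the bound for the number of \<open>w\<close> use different
      estimates of the fibres: \<open>b\<close> for the first, the geometric mean of
      \<open>a\<close> and \<open>b\<close> for the second. Both products then have size
      \<open>N * sqrt Q / (c * sqrt l)\<close>, with constants 4 * 19 = 76 and 2 * sqrt 38 \<le> 14,
      together 90.\<close>
    also have "\<dots> \<le> 4 * (sqrt Q * sqrt l / c) * b + 2 * sqrt N * sqrt (a * b)"
    proof (intro add_mono mult_left_mono)
      have "min a b * min a b \<le> a * b" using ab by (intro mult_mono) auto
      then show "min a b \<le> sqrt (a * b)" using ab by (intro real_le_rsqrt) (auto simp: power2_eq_square)
    qed (use Q1 l N c in auto)
    also have "4 * (sqrt Q * sqrt l / c) * b = 76 * (N * sqrt Q / (c * sqrt l))"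
    proof -
      have "sqrt l / l = 1 / sqrt l" using l by (simp add: frac_eq_eq)
      moreover have "4 * (sqrt Q * sqrt l / c) * b = 76 * (N * sqrt Q / c * (sqrt l / l))"
        by (simp add: b_def)
      ultimately show ?thesis by simp
    qed
    also have "2 * sqrt N * sqrt (a * b) \<le> 14 * (N * sqrt Q / (c * sqrt l))"
    proof -
      have "a * b = 38 * Q * N / ((real_of_int c)\<^sup>2 * l)" by (simp add: a_def b_def)
      then have "sqrt (a * b) = sqrt 38 * sqrt Q * sqrt N / (c * sqrt l)"
        using c by (simp add: real_sqrt_mult real_sqrt_divide)
      then have "2 * sqrt N * sqrt (a * b) = (2 * sqrt 38) * ((sqrt N * sqrt N) * sqrt Q / (c * sqrt l))"
        by (simp only: times_divide_eq_right mult_ac)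
      also have "\<dots> = (2 * sqrt 38) * (N * sqrt Q / (c * sqrt l))" using N by simp
      also have "\<dots> \<le> 14 * (N * sqrt Q / (c * sqrt l))"
      proof (rule mult_right_mono)
        have "sqrt 38 \<le> (7::real)" by (intro real_le_lsqrt) (auto simp: power2_eq_square)
        then show "2 * sqrt 38 \<le> (14::real)" by simp
      qed (use N Q1 c l in auto)
      finally show ?thesis .
    qed
    finally show ?thesis by (simp add: l_def field_simps)
  qed (use N Q1 c in auto)
qed

lemma sum_atLeastAtMost_int_symmetric:
  fixes f :: "int \<Rightarrow> real"
  assumes "\<And>i. f (- i) = f i"
  shows "sum f {- int n..int n} = f 0 + 2 * (\<Sum>i=1..n. f (int i))"
proof (induction n)
  case (Suc n)
  have "{- int (Suc n)..int (Suc n)} = insert (- int (Suc n)) (insert (int (Suc n)) {- int n..int n})"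
    by auto
  then have "sum f {- int (Suc n)..int (Suc n)} =
      f (- int (Suc n)) + (f (int (Suc n)) + sum f {- int n..int n})" by simp
  then show ?case using assms[of "int (Suc n)"] Suc by simp
qed simp

text \<open>The identity bounds \<open>Q * \<bar>L\<bar>\<close> by \<open>16 * Q * sqrt N\<close>
  from the square and \<open>Q * sqrt N\<close> from the remaining term, so only values up to
  \<open>17 * sqrt N\<close> occur. Summing the previous bound over nonzero \<open>L\<close>
  produces the fourth root of \<open>N\<close>; the value \<open>L = 0\<close> gives the second
  term.\<close>

lemma card_triples_fixed_fraction_le:
  fixes S :: "(int \<times> int \<times> int) set" and c d :: int and Q N :: real
  assumes fin: "finite S" and cd: "coprime c d" and c: "0 < c" and cQ: "of_int c ^ 2 * sqrt N \<le> Q"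
    and N: "1 \<le> N"
    and S: "\<And>q p r. (q, p, r) \<in> S \<Longrightarrow> Q \<le> q \<and> q < 2 * Q \<and> \<bar>q * r - p\<^sup>2\<bar> \<le> N \<and>
              (c * p - d * q)\<^sup>2 \<le> 16 * Q * sqrt N"
  shows "real (card S) \<le> 1500 * N * sqrt Q * sqrt (sqrt N) / c + 6 * sqrt N * Q / (real_of_int c)\<^sup>2"
proof -
  have sN: "1 \<le> sqrt N" using N by simp
  have c2: "1 \<le> real_of_int c ^ 2" using c by (intro one_le_power) simp
  have "real_of_int c ^ 2 * 1 \<le> of_int c ^ 2 * sqrt N" using sN by (intro mult_left_mono) auto
  then have cQ': "real_of_int c ^ 2 \<le> Q" using cQ by simp
  with c2 have Q1: "1 \<le> Q" by linarith
  define L :: "int \<times> int \<times> int \<Rightarrow> int"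
    where "L = (\<lambda>(q, p, r). c\<^sup>2 * r - 2 * c * d * p + d\<^sup>2 * q)"
  define n where "n = nat \<lfloor>17 * sqrt N\<rfloor>"
  define f where "f i = (if i = 0 then 6 * sqrt N * Q / (real_of_int c)\<^sup>2
    else 90 * N * sqrt Q / (c * sqrt \<bar>i\<bar>))" for i :: int
  have L_le: "\<bar>L (q, p, r)\<bar> \<le> 17 * sqrt N" if "(q, p, r) \<in> S" for q p r
  proof -
    define u where "u = real_of_int (c * p - d * q)"
    define m where "m = real_of_int (q * r - p\<^sup>2)"
    have "real_of_int q * L (q, p, r) = u\<^sup>2 + (real_of_int c)\<^sup>2 * m"
      using arg_cong[OF form_value_identity[of q c r d p], of real_of_int] by (simp add: L_def u_def m_def)
    then have "\<bar>real_of_int q * L (q, p, r)\<bar> \<le> \<bar>u\<^sup>2\<bar> + \<bar>(real_of_int c)\<^sup>2 * m\<bar>"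
      by (simp only: abs_triangle_ineq)
    also have "\<dots> = u\<^sup>2 + (real_of_int c)\<^sup>2 * \<bar>m\<bar>" by (simp add: abs_mult)
    also have "\<dots> \<le> u\<^sup>2 + (real_of_int c)\<^sup>2 * N"
      using S[OF that] by (intro add_left_mono mult_left_mono) (auto simp: m_def)
    also have "\<dots> \<le> 16 * Q * sqrt N + Q * sqrt N"
    proof (rule add_mono)
      show "u\<^sup>2 \<le> 16 * Q * sqrt N" using S[OF that] by (simp add: u_def)
      have "(real_of_int c)\<^sup>2 * sqrt N * sqrt N \<le> Q * sqrt N" using cQ N by (intro mult_right_mono) auto
      then show "(real_of_int c)\<^sup>2 * N \<le> Q * sqrt N" using N by (simp add: mult.assoc)
    qed
    finally have "\<bar>real_of_int q * L (q, p, r)\<bar> \<le> 17 * Q * sqrt N" by simp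
    moreover have "Q * \<bar>real_of_int (L (q, p, r))\<bar> \<le> \<bar>real_of_int q * L (q, p, r)\<bar>"
      using S[OF that] Q1 by (auto simp: abs_mult intro!: mult_right_mono)
    ultimately have "Q * \<bar>real_of_int (L (q, p, r))\<bar> \<le> Q * (17 * sqrt N)" by simp
    then show ?thesis using Q1 by simp
  qed
  have S_eq: "S = (\<Union>i\<in>{- int n..int n}. {t \<in> S. L t = i})"
  proof -
    have "L (q, p, r) \<in> {- int n..int n}" if "(q, p, r) \<in> S" for q p r
    proof -
      have "\<bar>L (q, p, r)\<bar> \<le> \<lfloor>17 * sqrt N\<rfloor>" using L_le[OF that] by (simp add: le_floor_iff)
      then show ?thesis unfolding n_def using N by auto
    qed
    then show ?thesis by auto
  qed
  have nN: "real n \<le> 17 * sqrt N" unfolding n_def using N by simp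
  have card: "real (card {t \<in> S. L t = i}) \<le> f i" if i: "i \<in> {- int n..int n}" for i
  proof -
    have i': "real_of_int \<bar>i\<bar> \<le> 17 * sqrt N"
    proof -
      have "real_of_int \<bar>i\<bar> \<le> real n" using i by auto
      then show ?thesis using nN by linarith
    qed
    have fin': "finite {t \<in> S. L t = i}" using fin by simp
    have S': "Q \<le> q \<and> q < 2 * Q \<and> \<bar>q * r - p\<^sup>2\<bar> \<le> N \<and> c\<^sup>2 * r - 2 * c * d * p + d\<^sup>2 * q = i"
      if "(q, p, r) \<in> {t \<in> S. L t = i}" for q p r
      using S[of q p r] that by (simp add: L_def)
    note * = card_triples_fixed_form_value_le[OF fin' cd c cQ' N i' S']
    show ?thesis using *(1) *(2) by (cases "i = 0") (simp_all add: f_def)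
  qed
  have "real (card S) \<le> (\<Sum>i\<in>{- int n..int n}. real (card {t \<in> S. L t = i}))"
    using card_UN_le[of "{- int n..int n}" "\<lambda>i. {t \<in> S. L t = i}"]
    by (simp flip: S_eq of_nat_sum)
  also have "\<dots> \<le> (\<Sum>i\<in>{- int n..int n}. f i)" by (intro sum_mono card)
  also have "\<dots> = f 0 + 2 * (\<Sum>i=1..n. f (int i))"
    by (rule sum_atLeastAtMost_int_symmetric) (simp add: f_def)
  also have "(\<Sum>i=1..n. f (int i)) = (\<Sum>i=1..n. 90 * N * sqrt Q / c * (1 / sqrt (real i)))"
    by (intro sum.cong) (auto simp: f_def)
  also have "\<dots> = 90 * N * sqrt Q / c * (\<Sum>i=1..n. 1 / sqrt (real i))"
    by (simp add: sum_distrib_left)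
  \<comment> \<open>25/3 is a rational bound for \<open>2 * sqrt 17\<close>; with both signs of
    \<open>L\<close> the constant becomes 2 * 90 * 25/3 = 1500.\<close>
  also have "\<dots> \<le> 90 * N * sqrt Q / c * (25/3 * sqrt (sqrt N))"
  proof (rule mult_left_mono)
    have "(\<Sum>i=1..n. 1 / sqrt (real i)) \<le> 2 * sqrt (real n)" by (rule sum_inverse_sqrt_le)
    also have "\<dots> \<le> 2 * sqrt (17 * sqrt N)" using nN by simp
    also have "\<dots> = 2 * sqrt 17 * sqrt (sqrt N)" by (simp add: real_sqrt_mult)
    also have "\<dots> \<le> 25/3 * sqrt (sqrt N)"
    proof (rule mult_right_mono)
      have "sqrt 17 \<le> (25/6::real)" by (intro real_le_lsqrt) (auto simp: power2_eq_square)
      then show "2 * sqrt 17 \<le> (25/3::real)" by simp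
    qed (use N in auto)
    finally show "(\<Sum>i=1..n. 1 / sqrt (real i)) \<le> 25/3 * sqrt (sqrt N)" .
  qed (use N Q1 c in auto)
  finally show ?thesis by (simp add: f_def)
qed

text \<open>Every \<open>p / q\<close> has a Dirichlet approximation \<open>d / c\<close> with
  \<open>c \<le> M\<close>, so the triples split into the classes of the previous lemma, with at
  most \<open>(2 * K + 3) * c\<close> numerators for each \<open>c\<close>. The logarithm comes from
  the harmonic sum over the terms with \<open>L = 0\<close>.\<close>

theorem card_integer_triples_near_cone_le:
  fixes S :: "(int \<times> int \<times> int) set" and K Q N :: real
  assumes Q: "1 \<le> Q" and N: "1 \<le> N" "N \<le> Q\<^sup>2" and K: "0 \<le> K"
    and S: "\<And>q p r. (q, p, r) \<in> S \<Longrightarrow> Q \<le> q \<and> q < 2 * Q \<and> \<bar>p\<bar> \<le> K * q \<and> \<bar>q * r - p\<^sup>2\<bar> \<le> N"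
  shows "finite S"
    and "real (card S) \<le> 1500 * (2 * K + 3) * (N * Q + sqrt N * Q * (1 + ln Q))"
proof -
  show fin: "finite S"
  proof (rule finite_subset)
    define m where "m = \<lceil>2 * Q\<rceil> + \<lceil>2 * K * Q\<rceil> + \<lceil>N\<rceil> + \<lceil>2 * K * Q\<rceil>\<^sup>2"
    show "S \<subseteq> {-m..m} \<times> {-m..m} \<times> {-m..m}"
    proof
      fix t assume "t \<in> S"
      moreover obtain q p r where t: "t = (q, p, r)" by (cases t)
      ultimately have "(q, p, r) \<in> S" by simp
      note s = S[OF this]
      have q: "1 \<le> q" using s Q by linarith
      have q2: "q \<le> \<lceil>2 * Q\<rceil>" using s by linarith
      have "K * q \<le> K * (2 * Q)" using s K by (intro mult_left_mono) auto
      then have "real_of_int \<bar>p\<bar> \<le> 2 * K * Q" using s by simp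
      then have p: "\<bar>p\<bar> \<le> \<lceil>2 * K * Q\<rceil>" by linarith
      then have p2: "p\<^sup>2 \<le> \<lceil>2 * K * Q\<rceil>\<^sup>2" by (metis abs_ge_zero power2_abs power_mono)
      have "real_of_int \<bar>q * r - p\<^sup>2\<bar> \<le> of_int \<lceil>N\<rceil>"
        using s by (auto intro: order.trans[OF _ le_of_int_ceiling])
      then have "\<bar>q * r - p\<^sup>2\<bar> \<le> \<lceil>N\<rceil>" by (simp only: of_int_le_iff)
      then have "\<bar>q * r\<bar> \<le> \<lceil>N\<rceil> + \<lceil>2 * K * Q\<rceil>\<^sup>2" using p2 zero_le_power2[of p] by linarith
      moreover have "1 * \<bar>r\<bar> \<le> \<bar>q\<bar> * \<bar>r\<bar>" using q by (intro mult_right_mono) auto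
      ultimately have r: "\<bar>r\<bar> \<le> \<lceil>N\<rceil> + \<lceil>2 * K * Q\<rceil>\<^sup>2" by (simp add: abs_mult)
      have "0 \<le> \<lceil>2 * K * Q\<rceil>" "0 \<le> \<lceil>N\<rceil>" using p r N by linarith+
      moreover have "0 \<le> \<lceil>2 * K * Q\<rceil>\<^sup>2" by simp
      ultimately have "\<bar>q\<bar> \<le> m" "\<bar>p\<bar> \<le> m" "\<bar>r\<bar> \<le> m"
        using q q2 p r unfolding m_def by linarith+
      then show "t \<in> {-m..m} \<times> {-m..m} \<times> {-m..m}" unfolding t by auto
    qed
  qed simp
  have sN: "1 \<le> sqrt N" using N by simp
  define G where "G = sqrt (sqrt N)"
  have G: "1 \<le> G" "G\<^sup>2 = sqrt N" using sN by (auto simp: G_def)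
  have "G\<^sup>2 \<le> Q" unfolding G using Q N by (intro real_le_lsqrt) auto
  then have GQ: "G \<le> sqrt Q" by (rule real_le_rsqrt)
  \<comment> \<open>\<open>M\<close> has the order of \<open>sqrt Q / G\<close>, with
    \<open>G\<close> the fourth root of \<open>N\<close>; \<open>N \<le> Q\<^sup>2\<close> makes it
    at least 1. The bound \<open>M * G \<le> sqrt Q\<close> keeps
    \<open>c\<^sup>2 * sqrt N \<le> Q\<close>, and \<open>sqrt Q \<le> 2 * M * G\<close> makes the
    Dirichlet error small enough for the bound \<open>16 * Q * sqrt N\<close>.\<close>
  define M where "M = nat \<lfloor>sqrt Q / G\<rfloor>"
  have "1 \<le> sqrt Q / G" using GQ G by simp
  then have fl: "1 \<le> \<lfloor>sqrt Q / G\<rfloor>" by (simp add: le_floor_iff)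
  then have M1: "1 \<le> M" and Mfl: "real M = of_int \<lfloor>sqrt Q / G\<rfloor>" unfolding M_def by linarith+
  then have "real M \<le> sqrt Q / G" by simp
  moreover have "sqrt Q / G \<le> 2 * real M"
    using fl real_of_int_floor_add_one_ge[of "sqrt Q / G"] unfolding Mfl by linarith
  ultimately have MG: "M * G \<le> sqrt Q" "sqrt Q \<le> 2 * M * G" using G by (simp_all add: field_simps)
  have MG2: "(real M)\<^sup>2 * sqrt N \<le> Q" "Q \<le> 4 * (real M)\<^sup>2 * sqrt N"
  proof -
    have "(M * G)\<^sup>2 \<le> (sqrt Q)\<^sup>2" using MG G by (intro power_mono) auto
    then show "(real M)\<^sup>2 * sqrt N \<le> Q" using Q by (simp add: power_mult_distrib G)
    have "(sqrt Q)\<^sup>2 \<le> (2 * M * G)\<^sup>2" using MG Q by (intro power_mono) auto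
    then show "Q \<le> 4 * (real M)\<^sup>2 * sqrt N" using Q by (simp add: power_mult_distrib G)
  qed
  \<comment> \<open>The range of \<open>d\<close> comes from
    \<open>\<bar>p\<bar> \<le> K * q\<close> and a Dirichlet error of at most 1.\<close>
  define D where "D c = {d::int. coprime c d \<and> \<bar>real_of_int d\<bar> \<le> c * K + 1}" for c :: int
  define T where "T c d = {(q, p, r) \<in> S. (c * p - d * q)\<^sup>2 \<le> 16 * Q * sqrt N}" for c d :: int
  define E where "E c = 1500 * N * sqrt Q * G / c + 6 * sqrt N * Q / (real_of_int c)\<^sup>2" for c :: int
  have finD: "finite (D c)" and cardD: "0 < c \<Longrightarrow> real (card (D c)) \<le> (2 * K + 3) * c" for c
  proof -
    define z where "z = \<lfloor>c * K + 1\<rfloor>"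
    have sub: "D c \<subseteq> {-z..z}"
    proof
      fix d assume "d \<in> D c"
      then have "real_of_int \<bar>d\<bar> \<le> c * K + 1" by (simp add: D_def)
      then have "\<bar>d\<bar> \<le> z" unfolding z_def by (metis le_floor_iff of_int_abs)
      then show "d \<in> {-z..z}" by auto
    qed
    then show "finite (D c)" using finite_subset by blast
    assume c: "0 < c"
    have "card (D c) \<le> card {-z..z}" using sub by (intro card_mono) auto
    also have "\<dots> = nat (2 * z + 1)" by simp
    finally have "card (D c) \<le> nat (2 * z + 1)" .
    moreover have "0 \<le> real_of_int c * K" using c K by simp
    then have "0 \<le> z" unfolding z_def by linarith
    ultimately have "real (card (D c)) \<le> 2 * real_of_int z + 1" by linarith
    also have "\<dots> \<le> 2 * (c * K + 1) + 1" unfolding z_def using of_int_floor_le[of "c * K + 1"] by simp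
    also have "\<dots> \<le> (2 * K + 3) * c" using c by (simp add: algebra_simps)
    finally show "real (card (D c)) \<le> (2 * K + 3) * c" .
  qed
  have cover: "S \<subseteq> (\<Union>c\<in>{1..int M}. \<Union>d\<in>D c. T c d)"
  proof clarify
    fix q p r assume t: "(q, p, r) \<in> S"
    note s = S[OF t]
    have q: "0 < real_of_int q" using s Q by linarith
    obtain d c where dc: "coprime d c" "0 < c" "c \<le> int M"
      "\<bar>of_int c * (real_of_int p / q) - of_int d\<bar> < 1 / real M"
      using Dirichlet_approx_coprime[of M "real_of_int p / q"] M1 by auto
    have "\<bar>real_of_int c * (real_of_int p / q)\<bar> = c * (\<bar>real_of_int p\<bar> / q)"
      using q dc by (simp add: abs_mult)
    also have "\<dots> \<le> c * K" using s q dc by (intro mult_left_mono) (auto simp: field_simps)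
    finally have "\<bar>real_of_int d\<bar> \<le> c * K + 1 / real M" using dc(4) by linarith
    also have "\<dots> \<le> c * K + 1" using M1 by simp
    finally have "d \<in> D c" using dc by (simp add: D_def coprime_commute)
    moreover have "(q, p, r) \<in> T c d"
    proof -
      have "real_of_int (c * p - d * q) = (of_int c * (real_of_int p / q) - of_int d) * q"
        using q by (simp add: field_simps)
      then have "\<bar>real_of_int (c * p - d * q)\<bar> = \<bar>of_int c * (real_of_int p / q) - of_int d\<bar> * q"
        using q by (simp only: abs_mult)
      also have "\<dots> \<le> 1 / real M * q" using dc(4) q by (intro mult_right_mono) auto
      also have "\<dots> \<le> 1 / real M * (2 * Q)" using s by (intro mult_left_mono) auto
      finally have "\<bar>real_of_int (c * p - d * q)\<bar>\<^sup>2 \<le> (1 / real M * (2 * Q))\<^sup>2"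
        by (intro power_mono) auto
      also have "\<dots> = 4 * Q * (Q / (real M)\<^sup>2)" by (simp add: power2_eq_square)
      also have "\<dots> \<le> 4 * Q * (4 * sqrt N)"
        using MG2(2) M1 Q by (intro mult_left_mono) (auto simp: field_simps)
      finally show ?thesis using t by (simp add: T_def)
    qed
    ultimately show "(q, p, r) \<in> (\<Union>c\<in>{1..int M}. \<Union>d\<in>D c. T c d)" using dc by auto
  qed
  have cardT: "real (card (T c d)) \<le> E c" if "c \<in> {1..int M}" "d \<in> D c" for c d
  proof -
    have "(real_of_int c)\<^sup>2 \<le> (real M)\<^sup>2" using that by (intro power_mono) auto
    then have "(real_of_int c)\<^sup>2 * sqrt N \<le> (real M)\<^sup>2 * sqrt N" using N by (intro mult_right_mono) auto
    then have "(real_of_int c)\<^sup>2 * sqrt N \<le> Q" using MG2(1) by linarith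
    moreover have "finite (T c d)" using fin by (rule finite_subset[rotated]) (auto simp: T_def)
    moreover have "coprime c d" "0 < c" using that by (auto simp: D_def)
    moreover have "Q \<le> q \<and> q < 2 * Q \<and> \<bar>q * r - p\<^sup>2\<bar> \<le> N \<and> (c * p - d * q)\<^sup>2 \<le> 16 * Q * sqrt N"
      if "(q, p, r) \<in> T c d" for q p r
      using S[of q p r] that by (simp add: T_def)
    ultimately show ?thesis
      unfolding E_def G_def using N(1) by (intro card_triples_fixed_fraction_le)
  qed
  have "card S \<le> card (\<Union>c\<in>{1..int M}. \<Union>d\<in>D c. T c d)"
  proof (rule card_mono[OF _ cover])
    have "(\<Union>c\<in>{1..int M}. \<Union>d\<in>D c. T c d) \<subseteq> S" by (auto simp: T_def)
    then show "finite (\<Union>c\<in>{1..int M}. \<Union>d\<in>D c. T c d)" using fin by (rule finite_subset)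
  qed
  also have "\<dots> \<le> (\<Sum>c\<in>{1..int M}. card (\<Union>d\<in>D c. T c d))" by (rule card_UN_le) simp
  also have "\<dots> \<le> (\<Sum>c\<in>{1..int M}. \<Sum>d\<in>D c. card (T c d))" by (intro sum_mono card_UN_le finD)
  finally have "real (card S) \<le> (\<Sum>c\<in>{1..int M}. \<Sum>d\<in>D c. real (card (T c d)))"
    by (simp flip: of_nat_sum)
  also have "\<dots> \<le> (\<Sum>c\<in>{1..int M}. \<Sum>d\<in>D c. E c)" by (intro sum_mono cardT)
  also have "\<dots> = (\<Sum>c\<in>{1..int M}. card (D c) * E c)" by simp
  also have "\<dots> \<le> (\<Sum>c\<in>{1..int M}. (2 * K + 3) * c * E c)"
    using N Q G by (intro sum_mono mult_right_mono cardD) (auto simp: E_def)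
  \<comment> \<open>The number of numerators cancels one power of \<open>c\<close>: the first term
    becomes constant in \<open>c\<close>, the second harmonic.\<close>
  also have "\<dots> = (\<Sum>c\<in>{1..int M}. (2 * K + 3) * (1500 * N * sqrt Q * G + 6 * sqrt N * Q * (1 / c)))"
    by (intro sum.cong) (auto simp: E_def power2_eq_square distrib_left)
  also have "\<dots> = (\<Sum>c=1..M. (2 * K + 3) * (1500 * N * sqrt Q * G + 6 * sqrt N * Q * (1 / real c)))"
    by (rule sum.reindex_bij_witness[of _ int nat]) auto
  also have "\<dots> = (2 * K + 3) * (1500 * N * sqrt Q * (M * G) + 6 * sqrt N * Q * (\<Sum>c=1..M. 1 / real c))"
    by (simp only: sum_distrib_left[symmetric] sum.distrib sum_constant) (simp add: mult_ac)
  also have "\<dots> \<le> (2 * K + 3) * (1500 * N * sqrt Q * sqrt Q + 1500 * sqrt N * Q * (1 + ln Q))"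
  proof (intro mult_left_mono add_mono mult_mono MG)
    have "real M \<le> Q"
    proof -
      have "real M * 1 \<le> real M * G" using G by (intro mult_left_mono) auto
      also have "\<dots> \<le> sqrt Q * 1" using MG by simp
      also have "\<dots> \<le> sqrt Q * sqrt Q" using Q by (intro mult_left_mono) auto
      finally show ?thesis using Q by simp
    qed
    then have "ln (real M) \<le> ln Q" using M1 by simp
    then show "(\<Sum>c=1..M. 1 / real c) \<le> 1 + ln Q" using sum_inverse_le_ln[OF M1] by linarith
  qed (use N Q K G in \<open>auto intro: sum_nonneg\<close>)
  also have "\<dots> = 1500 * (2 * K + 3) * (N * Q + sqrt N * Q * (1 + ln Q))"
  proof -
    have "1500 * N * sqrt Q * sqrt Q = 1500 * N * Q" using Q by (simp add: mult.assoc)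
    then show ?thesis by (simp only:) (simp add: algebra_simps)
  qed
  finally show "real (card S) \<le> 1500 * (2 * K + 3) * (N * Q + sqrt N * Q * (1 + ln Q))" .
qed

section \<open>Approximation on the parabola and the convergence argument\<close>

text \<open>The set consists of parameters \<open>x\<close> of points \<open>(x, x\<^sup>2)\<close>.
  The integers are explicit because \<open>(q, p, r)\<close> is the triple to be counted.\<close>

definition parabola_approx :: "(real \<Rightarrow> real) \<Rightarrow> real set" where
  "parabola_approx \<phi> = {x. \<forall>n::nat. \<exists>q\<ge>n. 1 \<le> q \<and>
     (\<exists>(p::int) (r::int). \<bar>real q * x - p\<bar> < \<phi> (real q) \<and> \<bar>real q * x\<^sup>2 - r\<bar> < \<phi> (real q))}"

text \<open>The convergence half of the Borel-Cantelli argument: \<open>E\<close> lies in every tail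
  union, and the tails of a convergent series tend to 0.\<close>

lemma hausdorff_content_limsup_eq_0:
  fixes A :: "nat \<Rightarrow> 'a::metric_space set"
  assumes "summable a" "\<And>k. 0 \<le> a k" "0 \<le> c"
    and A: "\<And>k. k0 \<le> k \<Longrightarrow> hausdorff_content s (A k) \<le> ennreal (c * a k)"
    and E: "\<And>m. E \<subseteq> (\<Union>k. A (k + m))"
  shows "hausdorff_content s E = 0"
proof -
  have "hausdorff_content s E \<le> 0"
  proof (rule ennreal_le_epsilon)
    fix e :: real assume e: "0 < e"
    have "(\<lambda>m. c * (\<Sum>k. a (k + m))) \<longlonglongrightarrow> c * 0"
      by (intro tendsto_mult tendsto_const suminf_exist_split2 assms)
    then have "\<forall>\<^sub>F m in sequentially. c * (\<Sum>k. a (k + m)) < e"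
      using e by (intro order_tendstoD) auto
    then have "\<forall>\<^sub>F m in sequentially. c * (\<Sum>k. a (k + m)) < e \<and> k0 \<le> m"
      by (intro eventually_conj eventually_ge_at_top)
    then obtain m where m: "c * (\<Sum>k. a (k + m)) < e" "k0 \<le> m"
      using eventually_happens'[OF sequentially_bot] by blast
    have sm: "summable (\<lambda>k. c * a (k + m))"
      using assms(1) by (intro summable_mult summable_ignore_initial_segment)
    have "hausdorff_content s E \<le> hausdorff_content s (\<Union>k. A (k + m))"
      using E by (rule hausdorff_content_mono)
    also have "\<dots> \<le> (\<Sum>k. hausdorff_content s (A (k + m)))"
      by (rule hausdorff_content_countable_subadditive)
    also have "\<dots> \<le> (\<Sum>k. ennreal (c * a (k + m)))"
      using m(2) by (intro suminf_le allI A summableI) auto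
    also have "\<dots> = ennreal (\<Sum>k. c * a (k + m))"
      using assms(2,3) sm by (intro suminf_ennreal2) auto
    also have "\<dots> = ennreal (c * (\<Sum>k. a (k + m)))"
      using assms(1) by (subst suminf_mult) (auto intro: summable_ignore_initial_segment)
    also have "\<dots> \<le> ennreal e" using m(1) by (intro ennreal_leI) simp
    finally show "hausdorff_content s E \<le> 0 + ennreal e" by simp
  qed
  then show ?thesis by simp
qed

lemma dyadic_block_containing:
  fixes q :: nat
  assumes "1 \<le> q" "2 ^ m \<le> q"
  obtains k where "m \<le> k" "2 ^ k \<le> q" "q < 2 ^ Suc k"
proof -
  obtain k where k: "2 ^ k \<le> q" "q < 2 ^ (k + 1)" using ex_power_ivl1[of 2 q] assms by auto
  have "(2::nat) ^ m < 2 ^ (k + 1)" using assms k by linarith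
  then have "m < k + 1" by (rule power_less_imp_less_exp[rotated]) simp
  then have "m \<le> k" by simp
  with k that show thesis by simp
qed

text \<open>For \<open>q\<close> in the block from \<open>2 ^ k\<close> to \<open>2 ^ Suc k\<close>,
  an approximation yields a triple near the cone and puts \<open>x\<close> within
  \<open>\<delta> k / 2 ^ k\<close> of \<open>p / q\<close>. The lower bound on \<phi> makes
  \<open>N k\<close> at least a positive power of \<open>2 ^ k\<close>, which beats the logarithm in
  the count.\<close>

lemma hausdorff_content_parabola_approx_aux:
  fixes \<phi> :: "real \<Rightarrow> real"
  assumes s: "0 < s" and \<tau>: "\<tau> < 1" and K: "0 \<le> K"
    and pos: "\<And>x. 0 < x \<Longrightarrow> 0 < \<phi> x" and mono: "\<And>x y. 0 < x \<Longrightarrow> x \<le> y \<Longrightarrow> \<phi> y \<le> \<phi> x"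
    and lower: "\<And>x. 1 \<le> x \<Longrightarrow> x powr - \<tau> \<le> \<phi> x"
    and sum: "summable (\<lambda>k::nat. (2 ^ k) powr (2 - s) * \<phi> (2 ^ k) powr (1 + s))"
  shows "hausdorff_content s (parabola_approx \<phi> \<inter> {-K..K}) = 0"
proof -
  define \<delta>0 where "\<delta>0 = \<phi> 1"
  \<comment> \<open>Chosen so that
    \<open>q * (r - q * x\<^sup>2) + (q * x - p) * (q * x + p)\<close>, which equals
    \<open>q * r - p\<^sup>2\<close>, is at most \<open>N k\<close> in absolute value.\<close>
  define C where "C = 2 + 4 * K + \<delta>0"
  define K' where "K' = K + \<delta>0"
  define \<delta> where "\<delta> k = \<phi> (2 ^ k)" for k :: nat
  define N where "N k = C * \<delta> k * 2 ^ k" for k :: nat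
  define S where "S k = {(q::int, p::int, r::int).
    2 ^ k \<le> real_of_int q \<and> real_of_int q < 2 * 2 ^ k \<and> \<bar>real_of_int p\<bar> \<le> K' * q \<and>
    \<bar>real_of_int (q * r - p\<^sup>2)\<bar> \<le> N k}" for k :: nat
  define A where "A k = (\<Union>(q, p, r)\<in>S k. cball (real_of_int p / q) (\<delta> k / 2 ^ k))" for k :: nat
  have d0: "0 < \<delta>0" using pos by (simp add: \<delta>0_def)
  have d: "0 < \<delta> k" "\<delta> k \<le> \<delta>0" for k using pos mono by (auto simp: \<delta>_def \<delta>0_def)
  have C1: "1 \<le> C" using K d0 by (simp add: C_def)
  have K'0: "0 \<le> K'" using K d0 by (simp add: K'_def)

  have E: "parabola_approx \<phi> \<inter> {-K..K} \<subseteq> (\<Union>k. A (k + m))" for m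
  proof
    fix x assume x: "x \<in> parabola_approx \<phi> \<inter> {-K..K}"
    then obtain q p r where q: "2 ^ m \<le> q" "1 \<le> q"
      and pr: "\<bar>real q * x - of_int p\<bar> < \<phi> (real q)" "\<bar>real q * x\<^sup>2 - of_int r\<bar> < \<phi> (real q)"
      unfolding parabola_approx_def by blast
    obtain k where k: "m \<le> k" "2 ^ k \<le> q" "q < 2 ^ Suc k" using dyadic_block_containing q by metis
    have k2: "2 ^ k \<le> real q" using k(2) by (metis of_nat_le_iff of_nat_numeral of_nat_power)
    have k3: "real q < 2 * 2 ^ k" using k(3) by (metis of_nat_less_iff of_nat_numeral of_nat_power power_Suc)
    have "\<phi> (real q) \<le> \<delta> k" unfolding \<delta>_def using k2 by (intro mono) auto
    then have p: "\<bar>real q * x - of_int p\<bar> \<le> \<delta> k" and r: "\<bar>real q * x\<^sup>2 - of_int r\<bar> \<le> \<delta> k"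
      using pr by linarith+
    have xK: "\<bar>x\<bar> \<le> K" using x by auto
    have qx: "\<bar>real q * x\<bar> \<le> real q * K" using xK by (simp add: abs_mult mult_left_mono)
    have q1: "1 \<le> real q" using q by simp
    have "\<bar>real_of_int p\<bar> \<le> real q * K + \<delta>0" using qx p d(2)[of k] by linarith
    also have "\<dots> \<le> real q * K + real q * \<delta>0" using q1 d0 by simp
    finally have p': "\<bar>real_of_int p\<bar> \<le> K' * real q" by (simp add: K'_def algebra_simps)
    have "\<bar>real q * real_of_int r - (real_of_int p)\<^sup>2\<bar> \<le> N k"
    proof -
      have "real q * real_of_int r - (real_of_int p)\<^sup>2 =
          real q * (real_of_int r - real q * x\<^sup>2) + (real q * x - p) * (real q * x + p)"
        by (simp add: algebra_simps power2_eq_square)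
      also have "\<bar>\<dots>\<bar> \<le> \<bar>real q * (real_of_int r - real q * x\<^sup>2)\<bar> + \<bar>(real q * x - p) * (real q * x + p)\<bar>"
        by (rule abs_triangle_ineq)
      also have "\<dots> \<le> (2 * 2 ^ k) * \<delta> k + \<delta> k * (4 * 2 ^ k * K + \<delta>0 * 2 ^ k)"
        unfolding abs_mult
      proof (intro add_mono mult_mono)
        have "real q * K \<le> (2 * 2 ^ k) * K" using k3 K by (intro mult_right_mono) auto
        moreover have "\<delta>0 * 1 \<le> \<delta>0 * 2 ^ k" using d0 by (intro mult_left_mono) auto
        ultimately show "\<bar>real q * x + real_of_int p\<bar> \<le> 4 * 2 ^ k * K + \<delta>0 * 2 ^ k"
          using qx p d(2)[of k] by linarith
      qed (use k3 p r d[of k] in \<open>auto simp: abs_minus_commute\<close>)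
      also have "\<dots> = N k" by (simp add: N_def C_def algebra_simps)
      finally show ?thesis .
    qed
    then have "(int q, p, r) \<in> S k" using k2 k3 p' by (simp add: S_def)
    moreover have "x \<in> cball (real_of_int p / real_of_int (int q)) (\<delta> k / 2 ^ k)"
    proof -
      have "real q * \<bar>x - of_int p / q\<bar> = \<bar>real q * (x - of_int p / q)\<bar>" by (simp add: abs_mult)
      also have "\<dots> = \<bar>real q * x - of_int p\<bar>" using q1 by (simp add: right_diff_distrib)
      also have "\<dots> \<le> \<delta> k" by (rule p)
      finally have "\<bar>x - of_int p / q\<bar> \<le> \<delta> k / q" using q1 by (simp add: field_simps)
      also have "\<dots> \<le> \<delta> k / 2 ^ k" using k2 d(1)[of k] q1 by (intro divide_left_mono mult_pos_pos) auto
      finally show ?thesis by (simp add: dist_real_def abs_minus_commute)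
    qed
    ultimately have "x \<in> A k" unfolding A_def by (intro UN_I[of "(int q, p, r)"]) auto
    then show "x \<in> (\<Union>k. A (k + m))" using k(1) by (auto intro!: exI[of _ "k - m"])
  qed

  \<comment> \<open>For large \<open>x\<close> the logarithm is below the square root of
    \<open>N\<close>, and \<open>C * \<delta>0 \<le> x\<close> ensures the hypothesis
    \<open>N \<le> Q\<^sup>2\<close> of the count.\<close>
  have "\<forall>\<^sub>F x::real in at_top. 1 + ln x \<le> sqrt (x powr (1 - \<tau>)) \<and> C * \<delta>0 \<le> x \<and> 1 \<le> x"
  proof (intro eventually_conj eventually_ge_at_top)
    show "\<forall>\<^sub>F x::real in at_top. 1 + ln x \<le> sqrt (x powr (1 - \<tau>))"
      using \<tau> by real_asymp
  qed
  moreover have "filterlim (\<lambda>k::nat. (2::real) ^ k) at_top sequentially" by real_asymp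
  ultimately have "\<forall>\<^sub>F k in sequentially. 1 + ln (2 ^ k :: real) \<le> sqrt ((2 ^ k) powr (1 - \<tau>)) \<and>
      C * \<delta>0 \<le> 2 ^ k \<and> (1::real) \<le> 2 ^ k"
    by (rule eventually_compose_filterlim)
  then obtain k0 where k0: "\<And>k. k0 \<le> k \<Longrightarrow> 1 + ln (2 ^ k :: real) \<le> sqrt ((2 ^ k) powr (1 - \<tau>)) \<and>
      C * \<delta>0 \<le> 2 ^ k"
    unfolding eventually_sequentially by blast
  define c where "c = 3000 * (2 * K' + 3) * C * 2 powr s"
  have c0: "0 \<le> c" using K'0 C1 by (simp add: c_def)
  have content: "hausdorff_content s (A k) \<le> ennreal (c * ((2 ^ k) powr (2 - s) * \<phi> (2 ^ k) powr (1 + s)))"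
    if k: "k0 \<le> k" for k
  proof -
    define Q :: real where "Q = 2 ^ k"
    have Q: "1 \<le> Q" by (simp add: Q_def)
    have N1: "sqrt (Q powr (1 - \<tau>)) \<le> sqrt (N k)"
    proof -
      have "Q powr (1 - \<tau>) = 1 * Q powr - \<tau> * Q" using Q by (simp add: powr_diff powr_minus field_simps)
      also have "\<dots> \<le> C * \<delta> k * Q"
        using Q C1 lower[OF Q] d(1)[of k] by (intro mult_mono) (auto simp: \<delta>_def Q_def)
      finally show ?thesis by (simp add: N_def Q_def)
    qed
    then have lnN: "1 + ln Q \<le> sqrt (N k)" using k0[OF k] unfolding Q_def by linarith
    moreover have "0 \<le> ln Q" using Q by simp
    ultimately have "1 \<le> sqrt (N k)" by linarith
    then have N1: "1 \<le> N k" by simp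
    have NQ: "N k \<le> Q\<^sup>2"
    proof -
      have "N k = (C * \<delta> k) * Q" by (simp add: N_def Q_def)
      also have "\<dots> \<le> Q * Q"
      proof (rule mult_right_mono)
        have "C * \<delta> k \<le> C * \<delta>0" using d C1 by (intro mult_left_mono) auto
        then show "C * \<delta> k \<le> Q" using k0[OF k] by (simp add: Q_def)
      qed (use Q in auto)
      finally show ?thesis by (simp add: power2_eq_square)
    qed
    have fin: "finite (S k)" and "real (card (S k)) \<le> 1500 * (2 * K' + 3) * (N k * Q + sqrt (N k) * Q * (1 + ln Q))"
      by (rule card_integer_triples_near_cone_le[OF Q N1 NQ K'0]; auto simp: S_def Q_def)+
    note this(2)
    \<comment> \<open>With \<open>1 + ln Q \<le> sqrt (N k)\<close> the logarithmic term is no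
      larger than the main term, so 1500 merely doubles.\<close>
    also have "\<dots> \<le> 1500 * (2 * K' + 3) * (N k * Q + sqrt (N k) * Q * sqrt (N k))"
      using lnN K'0 Q N1 by (intro mult_left_mono add_left_mono) auto
    also have "sqrt (N k) * Q * sqrt (N k) = N k * Q" using N1 by (simp add: mult_ac)
    also have "1500 * (2 * K' + 3) * (N k * Q + N k * Q) = 3000 * (2 * K' + 3) * C * \<delta> k * Q\<^sup>2"
      by (simp add: N_def Q_def power2_eq_square algebra_simps)
    finally have card: "real (card (S k)) \<le> 3000 * (2 * K' + 3) * C * \<delta> k * Q\<^sup>2" .
    have "hausdorff_content s (A k) \<le> (\<Sum>(q, p, r)\<in>S k. hausdorff_content s (cball (real_of_int p / q) (\<delta> k / 2 ^ k)))"
      unfolding A_def using hausdorff_content_finite_UN_le[OF fin, of s "\<lambda>(q, p, r). cball (real_of_int p / q) (\<delta> k / 2 ^ k)"]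
      by (simp add: case_prod_unfold)
    also have "\<dots> \<le> (\<Sum>t\<in>S k. ennreal ((2 * (\<delta> k / Q)) powr s))"
    proof (rule sum_mono, clarify)
      fix q p r :: int
      have "hausdorff_content s (cball (real_of_int p / q) (\<delta> k / 2 ^ k))
          \<le> ennreal (diameter (cball (real_of_int p / q) (\<delta> k / 2 ^ k)) powr s)"
        by (intro hausdorff_content_le_diameter) auto
      also have "diameter (cball (real_of_int p / q) (\<delta> k / 2 ^ k)) = 2 * (\<delta> k / Q)"
        using divide_nonneg_nonneg[of "\<delta> k" "2 ^ k"] d(1)[of k] by (simp add: Q_def not_less)
      finally show "hausdorff_content s (cball (real_of_int p / q) (\<delta> k / 2 ^ k))
          \<le> ennreal ((2 * (\<delta> k / Q)) powr s)" .
    qed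
    also have "\<dots> = of_nat (card (S k)) * ennreal ((2 * (\<delta> k / Q)) powr s)" by simp
    also have "\<dots> = ennreal (real (card (S k)) * (2 * (\<delta> k / Q)) powr s)"
      by (simp add: ennreal_mult ennreal_of_nat_eq_real_of_nat)
    also have "\<dots> \<le> ennreal (3000 * (2 * K' + 3) * C * \<delta> k * Q\<^sup>2 * (2 * (\<delta> k / Q)) powr s)"
      using card by (intro ennreal_leI mult_right_mono) auto
    \<comment> \<open>The number of balls times the \<open>s\<close>-th power of their diameters is
      a constant times the term of the given series.\<close>
    also have "3000 * (2 * K' + 3) * C * \<delta> k * Q\<^sup>2 * (2 * (\<delta> k / Q)) powr s =
        c * (Q powr (2 - s) * \<delta> k powr (1 + s))"
    proof -
      have 1: "\<delta> k powr (1 + s) = \<delta> k * \<delta> k powr s" using d(1)[of k] by (simp add: powr_add)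
      have 2: "Q powr (2 - s) = Q\<^sup>2 / Q powr s" using Q by (simp add: powr_diff)
      have 3: "(2 * (\<delta> k / Q)) powr s = 2 powr s * (\<delta> k powr s / Q powr s)"
        using d(1)[of k] Q by (simp add: powr_mult powr_divide)
      show ?thesis unfolding 1 2 3 c_def by simp
    qed
    finally show ?thesis by (simp add: Q_def \<delta>_def)
  qed
  show ?thesis
    by (rule hausdorff_content_limsup_eq_0[where A = A, OF sum _ c0 content E]) auto
qed

text \<open>Enlarging \<phi> to at least \<open>x powr - \<tau>\<close> only enlarges the set. The
  series survives if \<open>(2 - s) / (1 + s) < \<tau>\<close>, and the previous lemma asks for
  \<open>\<tau> < 1\<close>; such a \<tau> exists because \<open>s > 1/2\<close>.\<close>

theorem hausdorff_content_parabola_approx: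
  fixes \<phi> :: "real \<Rightarrow> real"
  assumes s: "1/2 < s" and K: "0 \<le> K"
    and pos: "\<And>x. 0 < x \<Longrightarrow> 0 < \<phi> x" and mono: "\<And>x y. 0 < x \<Longrightarrow> x \<le> y \<Longrightarrow> \<phi> y \<le> \<phi> x"
    and sum: "summable (\<lambda>k::nat. (2 ^ k) powr (2 - s) * \<phi> (2 ^ k) powr (1 + s))"
  shows "hausdorff_content s (parabola_approx \<phi> \<inter> {-K..K}) = 0"
proof -
  have "(2 - s) / (1 + s) < 1" using s by (simp add: field_simps)
  then obtain \<tau>' where \<tau>': "(2 - s) / (1 + s) < \<tau>'" "\<tau>' < 1" using dense by blast
  \<comment> \<open>The maximum with 1/2 keeps \<tau> positive for large \<open>s\<close> too, so
    that \<open>x powr - \<tau>\<close> decreases.\<close>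
  define \<tau> where "\<tau> = max \<tau>' (1/2)"
  have \<tau>: "(2 - s) / (1 + s) < \<tau>" "\<tau> < 1" "0 < \<tau>" using \<tau>' by (auto simp: \<tau>_def)
  define \<phi>' where "\<phi>' x = max (\<phi> x) (x powr - \<tau>)" for x
  have le: "\<phi> x \<le> \<phi>' x" for x by (simp add: \<phi>'_def)
  have "parabola_approx \<phi> \<subseteq> parabola_approx \<phi>'"
    unfolding parabola_approx_def using le by (blast intro: less_le_trans)
  then have "hausdorff_content s (parabola_approx \<phi> \<inter> {-K..K})
      \<le> hausdorff_content s (parabola_approx \<phi>' \<inter> {-K..K})"
    by (intro hausdorff_content_mono) auto
  also have "\<dots> = 0"
  proof (rule hausdorff_content_parabola_approx_aux[OF _ \<tau>(2) K])
    show "0 < \<phi>' x" if "0 < x" for x using pos[OF that] le[of x] by linarith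
    show "\<phi>' y \<le> \<phi>' x" if "0 < x" "x \<le> y" for x y
      unfolding \<phi>'_def using mono[OF that] that \<tau>(3) by (intro max.mono) (auto intro: powr_mono2')
    show "x powr - \<tau> \<le> \<phi>' x" for x by (simp add: \<phi>'_def)
    define e where "e = \<tau> * (1 + s) - (2 - s)"
    have e: "0 < e" using \<tau>(1) s by (simp add: e_def field_simps)
    have bnd: "\<bar>(2 ^ k) powr (2 - s) * \<phi>' (2 ^ k) powr (1 + s)\<bar> \<le>
        (2 ^ k) powr (2 - s) * \<phi> (2 ^ k) powr (1 + s) + (2 powr - e) ^ k" for k :: nat
    proof -
      define Q :: real where "Q = 2 ^ k"
      have Q: "0 < Q" by (simp add: Q_def)
      \<comment> \<open>The maximum equals one of its two entries, so its power is at most the sum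
        of both powers; the added part is geometric with ratio \<open>2 powr - e\<close>.\<close>
      have "\<phi>' Q powr (1 + s) \<le> \<phi> Q powr (1 + s) + (Q powr - \<tau>) powr (1 + s)"
        unfolding \<phi>'_def max_def by simp
      then have "Q powr (2 - s) * \<phi>' Q powr (1 + s) \<le> Q powr (2 - s) * (\<phi> Q powr (1 + s) + (Q powr - \<tau>) powr (1 + s))"
        by (intro mult_left_mono) auto
      also have "\<dots> = Q powr (2 - s) * \<phi> Q powr (1 + s) + Q powr (2 - s) * (Q powr - \<tau>) powr (1 + s)"
        by (rule distrib_left)
      also have "Q powr (2 - s) * (Q powr - \<tau>) powr (1 + s) = Q powr - e"
        by (simp add: powr_powr e_def algebra_simps flip: powr_add)
      also have "\<dots> = (2 powr - e) ^ k"
        by (simp add: Q_def powr_powr mult.commute flip: powr_realpow)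
      finally show ?thesis by (simp add: Q_def)
    qed
    have "summable (\<lambda>k::nat. (2 powr - e) ^ k)"
      using e by (intro summable_geometric) (auto simp: powr_minus inverse_eq_divide)
    then have "summable (\<lambda>k::nat. (2 ^ k) powr (2 - s) * \<phi> (2 ^ k) powr (1 + s) + (2 powr - e) ^ k)"
      by (intro summable_add sum)
    then show "summable (\<lambda>k::nat. (2 ^ k) powr (2 - s) * \<phi>' (2 ^ k) powr (1 + s))"
      by (rule summable_comparison_test'[where N = 0]) (simp only: real_norm_def bnd)
  qed (use s in auto)
  finally show ?thesis by simp
qed

section \<open>Condensation of the series and rescaling\<close>

text \<open>The Cauchy condensation of the series in the theorem: \<open>2 ^ k\<close> terms with
  weight \<open>(2 ^ k) powr (1 - s)\<close> give the exponent \<open>2 - s\<close>.\<close>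

definition dyadic_summable :: "real \<Rightarrow> (real \<Rightarrow> real) \<Rightarrow> bool" where
  "dyadic_summable s \<phi> \<longleftrightarrow> summable (\<lambda>k::nat. (2 ^ k) powr (2 - s) * \<phi> (2 ^ k) powr (1 + s))"

lemma approximating_functionD:
  assumes "approximating_function \<psi>"
  shows "0 < x \<Longrightarrow> 0 < \<psi> x" "0 < x \<Longrightarrow> x \<le> y \<Longrightarrow> \<psi> y \<le> \<psi> x"
  using assms unfolding approximating_function_def by (auto simp: Pi_iff monotone_on_def)

lemma approximating_function_scale:
  assumes "approximating_function \<psi>" "0 < c"
  shows "approximating_function (\<lambda>t. c * \<psi> (t / 2 ^ d))"
  using assms unfolding approximating_function_def
  by (auto simp: Pi_iff monotone_on_def divide_right_mono)

text \<open>Dilations are restricted to powers of 2 so that rescaling the argument is an index shift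
  by \<open>d\<close>, up to a constant factor.\<close>

lemma dyadic_summable_scale:
  assumes "dyadic_summable s \<psi>" "0 < c" "approximating_function \<psi>"
  shows "dyadic_summable s (\<lambda>t. c * \<psi> (t / 2 ^ d))"
proof -
  have "((2 ^ (k + d)) powr (2 - s) * (c * \<psi> (2 ^ (k + d) / 2 ^ d)) powr (1 + s)) =
      ((2 ^ d) powr (2 - s) * c powr (1 + s)) * ((2 ^ k) powr (2 - s) * \<psi> (2 ^ k) powr (1 + s))"
    for k :: nat
    using approximating_functionD(1)[OF assms(3), of "2 ^ k"] assms(2)
    by (simp add: power_add powr_mult)
  then have "summable (\<lambda>k. (2 ^ (k + d)) powr (2 - s) * (c * \<psi> (2 ^ (k + d) / 2 ^ d)) powr (1 + s))"
    using assms(1) unfolding dyadic_summable_def by (simp only: summable_mult)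
  then show ?thesis
    unfolding dyadic_summable_def by (subst (asm) summable_iff_shift)
qed

text \<open>In the block above \<open>2 ^ k\<close> up to \<open>2 ^ Suc k\<close>, the weight is
  least at the left end and \<psi> at the right end, so the block sum is at least
  \<open>a k\<close>.\<close>

lemma dyadic_summableI:
  fixes s :: real
  assumes s: "-1 < s" "s < 1" and \<psi>: "approximating_function \<psi>"
    and sum: "summable (\<lambda>n::nat. real (Suc n) powr (1 - s) * \<psi> (real (Suc n)) powr (s + 1))"
  shows "dyadic_summable s \<psi>"
proof -
  define f where "f n = real n powr (1 - s) * \<psi> (real n) powr (s + 1)" for n :: nat
  define a where "a k = (2 ^ k) powr (2 - s) * \<psi> (2 ^ Suc k) powr (1 + s)" for k :: nat
  have f0: "0 \<le> f n" for n by (simp add: f_def)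
  have block: "a k \<le> (\<Sum>n\<in>{2^k<..(2::nat)^Suc k}. f n)" for k
  proof -
    have "(2 ^ k) powr (1 - s) * \<psi> (2 ^ Suc k) powr (s + 1) \<le> f n" if n: "n \<in> {2^k<..(2::nat)^Suc k}" for n
    proof -
      have 1: "2 ^ k \<le> real n" using n by (metis greaterThanAtMost_iff less_imp_le of_nat_le_iff of_nat_numeral of_nat_power)
      have 2: "real n \<le> 2 ^ Suc k" using n by (metis greaterThanAtMost_iff of_nat_le_iff of_nat_numeral of_nat_power)
      have 3: "0 < real n" using n by auto
      have "\<psi> (2 ^ Suc k) powr (s + 1) \<le> \<psi> (real n) powr (s + 1)"
        using s approximating_functionD[OF \<psi>] 2 3 by (intro powr_mono2) (auto intro: less_imp_le)
      moreover have "(2 ^ k) powr (1 - s) \<le> real n powr (1 - s)"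
        using s 1 by (intro powr_mono2) auto
      ultimately show ?thesis unfolding f_def by (intro mult_mono) auto
    qed
    then have "(\<Sum>n\<in>{2^k<..(2::nat)^Suc k}. (2 ^ k) powr (1 - s) * \<psi> (2 ^ Suc k) powr (s + 1)) \<le> (\<Sum>n\<in>{2^k<..(2::nat)^Suc k}. f n)"
      by (intro sum_mono) (auto simp del: power_Suc)
    also have "(\<Sum>n\<in>{2^k<..(2::nat)^Suc k}. (2 ^ k) powr (1 - s) * \<psi> (2 ^ Suc k) powr (s + 1)) = a k"
    proof -
      have "(2 ^ k) powr (2 - s) = 2 ^ k * (2 ^ k :: real) powr (1 - s)"
        using powr_add[of "2 ^ k :: real" 1 "1 - s"] by simp
      then show ?thesis by (simp add: a_def add.commute)
    qed
    finally show ?thesis .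
  qed
  have "(\<Sum>k<m. a k) \<le> (\<Sum>n\<in>{1<..2^m}. f n)" for m
  proof (induction m)
    case (Suc m)
    have "{1<..2^Suc m} = {1<..2^m} \<union> {2^m<..(2::nat)^Suc m}"
      by (intro ivl_disj_un_two(6)[symmetric]) auto
    then have "(\<Sum>n\<in>{1<..2^Suc m}. f n) = (\<Sum>n\<in>{1<..2^m}. f n) + (\<Sum>n\<in>{2^m<..(2::nat)^Suc m}. f n)"
      by (simp only:, intro sum.union_disjoint) auto
    with Suc block[of m] show ?case by simp
  qed simp
  also have "(\<Sum>n\<in>{1<..2^m}. f n) \<le> (\<Sum>n<2^m. f (Suc n))" for m :: nat
  proof -
    have "(\<Sum>n\<in>{1<..2^m}. f n) \<le> (\<Sum>n\<in>Suc ` {..<2^m}. f n)"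
      by (intro sum_mono2 f0) (auto simp: image_Suc_lessThan)
    then show ?thesis by (simp add: sum.reindex)
  qed
  also have "(\<Sum>n<2^m. f (Suc n)) \<le> (\<Sum>n. f (Suc n))" for m :: nat
    using sum f0 by (intro sum_le_suminf) (auto simp: f_def)
  finally have "summable a"
    by (intro summableI_nonneg_bounded) (auto simp: a_def)
  \<comment> \<open>The factor lifts the weight from \<open>2 ^ k\<close> to
    \<open>2 ^ Suc k\<close>, where \<psi> is already evaluated; the result is the condensed series
    without its first term.\<close>
  then have "summable (\<lambda>k. 2 powr (2 - s) * a k)" by (rule summable_mult)
  also have "(\<lambda>k. 2 powr (2 - s) * a k) = (\<lambda>k. (2 ^ Suc k) powr (2 - s) * \<psi> (2 ^ Suc k) powr (1 + s))"
    by (simp add: a_def powr_mult mult_ac fun_eq_iff)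
  finally show ?thesis
    unfolding dyadic_summable_def by (subst (asm) summable_Suc_iff)
qed

section \<open>From arcs of conics to the parabola\<close>

text \<open>If \<open>P\<^sub>0\<close>, \<open>P\<^sub>1\<close>, \<open>P\<^sub>2\<close> are integers close to \<open>q G\<^sub>0\<close>, \<open>q G\<^sub>1\<close>, \<open>q G\<^sub>2\<close>, then \<open>\<bar>P\<^sub>0\<bar>\<close> serves as a
  denominator in approximations to \<open>x = G\<^sub>1 / G\<^sub>0\<close> and \<open>x\<^sup>2 = G\<^sub>2 / G\<^sub>0\<close>.\<close>

lemma mem_parabola_approxI:
  fixes x G0 K M B :: real
  assumes \<psi>: "approximating_function \<psi>" and K: "\<bar>x\<bar> \<le> K" "1 \<le> K" and B: "0 < B"
    and G0: "G0 \<noteq> 0" "\<bar>G0\<bar> + B * \<psi> 1 \<le> 2 ^ d"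
    and inf: "\<And>n::nat. \<exists>q\<ge>n. 1 \<le> q \<and> (\<exists>(P0::int) (P1::int) (P2::int).
       \<bar>real q * G0 - P0\<bar> < B * \<psi> (real q) \<and> \<bar>real q * (x * G0) - P1\<bar> < B * \<psi> (real q) \<and>
       \<bar>real q * (x\<^sup>2 * G0) - P2\<bar> < B * \<psi> (real q))"
  shows "x \<in> parabola_approx (\<lambda>t. (2 * K\<^sup>2 * B) * \<psi> (t / 2 ^ d))"
  unfolding parabola_approx_def
proof clarify
  fix n :: nat
  \<comment> \<open>For \<open>q \<ge> n'\<close> the integer \<open>P0\<close>, close to
    \<open>q * G0\<close>, has absolute value at least \<open>n + 1\<close>; so the new denominators
    are unbounded.\<close>
  obtain n' :: nat where n': "(real n + 1 + B * \<psi> 1) / \<bar>G0\<bar> \<le> real n'" using real_arch_simple by blast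
  obtain q P0 P1 P2 where q: "n' \<le> q" "1 \<le> q"
    and P0: "\<bar>real q * G0 - of_int P0\<bar> < B * \<psi> (real q)"
    and P1: "\<bar>real q * (x * G0) - of_int P1\<bar> < B * \<psi> (real q)"
    and P2: "\<bar>real q * (x\<^sup>2 * G0) - of_int P2\<bar> < B * \<psi> (real q)"
    using inf[of n'] by blast
  define q' where "q' = nat \<bar>P0\<bar>"
  have q': "real q' = \<bar>of_int P0\<bar>" by (simp add: q'_def)
  have \<psi>1: "\<psi> (real q) \<le> \<psi> 1" "0 < \<psi> (real q)" "0 < \<psi> 1"
    using approximating_functionD[OF \<psi>] q by auto
  have B1: "B * \<psi> (real q) \<le> B * \<psi> 1" using \<psi>1 B by simp
  have "real n + 1 + B * \<psi> 1 \<le> real n' * \<bar>G0\<bar>" using n' G0 by (simp add: field_simps)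
  also have "\<dots> \<le> real q * \<bar>G0\<bar>" using q by (intro mult_right_mono) auto
  also have "\<dots> = \<bar>real q * G0\<bar>" by (simp add: abs_mult)
  finally have "real n + 1 \<le> real q'" using P0 B1 q' by linarith
  then have qn: "n \<le> q'" "1 \<le> q'" by linarith+
  \<comment> \<open>An upper bound \<open>2 ^ d * q\<close> for the new denominator is needed too:
    it turns \<psi> at \<open>q\<close> into \<psi> at \<open>q' / 2 ^ d\<close> by
    monotonicity.\<close>
  have "real q' \<le> real q * \<bar>G0\<bar> + B * \<psi> 1" using P0 B1 q' abs_mult[of "real q" G0] by simp
  also have "\<dots> \<le> real q * \<bar>G0\<bar> + real q * (B * \<psi> 1)" using q B \<psi>1 by simp
  also have "\<dots> = real q * (\<bar>G0\<bar> + B * \<psi> 1)" by (simp add: algebra_simps)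
  also have "\<dots> \<le> real q * 2 ^ d" using G0 by (intro mult_left_mono) auto
  finally have "real q' / 2 ^ d \<le> real q" by (simp add: field_simps)
  then have \<psi>q: "\<psi> (real q) \<le> \<psi> (real q' / 2 ^ d)"
    using approximating_functionD[OF \<psi>] qn by simp
  define \<epsilon> where "\<epsilon> = B * \<psi> (real q)"
  have e: "0 < \<epsilon>" "2 * K\<^sup>2 * \<epsilon> \<le> 2 * K\<^sup>2 * B * \<psi> (real q' / 2 ^ d)"
    using \<psi>q \<psi>1 B K by (auto simp: \<epsilon>_def mult.assoc intro!: mult_left_mono)
  \<comment> \<open>The sign moves from \<open>P0\<close> to the numerators, since denominators must
    be positive. The errors of \<open>P\<close> and of \<open>y\<close> times \<open>P0\<close> add
    up to \<open>(1 + K\<^sup>2) * \<epsilon>\<close>, and \<open>1 \<le> K\<close>.\<close>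
  have approx: "\<bar>real q' * y - of_int (sgn P0 * P)\<bar> < 2 * K\<^sup>2 * B * \<psi> (real q' / 2 ^ d)"
    if y: "\<bar>y\<bar> \<le> K\<^sup>2" and P: "\<bar>real q * (y * G0) - of_int P\<bar> < \<epsilon>" for y and P :: int
  proof -
    have "real q' * y - of_int (sgn P0 * P) = of_int (sgn P0) * (of_int P0 * y - of_int P)"
      by (simp add: q' sgn_if algebra_simps)
    also have "\<bar>\<dots>\<bar> \<le> \<bar>of_int P0 * y - of_int P\<bar>" by (simp add: abs_mult sgn_if)
    also have "\<dots> = \<bar>(real q * (y * G0) - of_int P) - y * (real q * G0 - of_int P0)\<bar>"
      by (simp add: algebra_simps)
    also have "\<dots> \<le> \<bar>real q * (y * G0) - of_int P\<bar> + \<bar>y\<bar> * \<bar>real q * G0 - of_int P0\<bar>"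
      by (rule order.trans[OF abs_triangle_ineq4]) (simp add: abs_mult)
    also have "\<dots> < \<epsilon> + K\<^sup>2 * \<epsilon>"
      using P y P0 e by (intro add_less_le_mono mult_mono) (auto simp: \<epsilon>_def)
    also have "\<dots> \<le> 2 * K\<^sup>2 * \<epsilon>" using K e by (simp add: mult_mono algebra_simps)
    finally show ?thesis using e by linarith
  qed
  have "\<bar>x\<bar> \<le> K\<^sup>2" using K self_le_power[of K 2] by simp
  moreover have "\<bar>x\<^sup>2\<bar> \<le> K\<^sup>2" using K by (simp add: abs_le_square_iff[symmetric])
  ultimately show "\<exists>q\<ge>n. 1 \<le> q \<and> (\<exists>p r. \<bar>real q * x - real_of_int p\<bar> < 2 * K\<^sup>2 * B * \<psi> (real q / 2 ^ d) \<and>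
       \<bar>real q * x\<^sup>2 - real_of_int r\<bar> < 2 * K\<^sup>2 * B * \<psi> (real q / 2 ^ d))"
    using qn approx P1 P2 unfolding \<epsilon>_def by blast
qed

lemma mem_simult_approx_iff:
  "y \<in> simult_approx \<psi> \<longleftrightarrow> (\<forall>n::nat. \<exists>q\<ge>n. 1 \<le> q \<and>
     (\<exists>(p1::int) (p2::int). \<bar>real q * y $ 1 - p1\<bar> < \<psi> (real q) \<and> \<bar>real q * y $ 2 - p2\<bar> < \<psi> (real q)))"
proof -
  have *: "int_dist x < b \<longleftrightarrow> (\<exists>p::int. \<bar>x - p\<bar> < b)" for x b
    using int_dist_attained[of x] int_dist_le[of x] by (metis le_less_trans)
  show ?thesis
    unfolding simult_approx_def infinite_nat_iff_unbounded_le max_less_iff_conj mem_Collect_eq * by blast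
qed

definition integral_affine_form :: "(real ^ 2 \<Rightarrow> real) \<Rightarrow> bool" where
  "integral_affine_form g \<longleftrightarrow>
     (\<exists>(a::int) (b::int) (c::int). \<forall>z. g z = of_int a + of_int b * z $ 1 + of_int c * z $ 2)"

lemma integral_affine_formI:
  assumes "\<And>z. g z = of_int a + of_int b * z $ 1 + of_int c * z $ 2"
  shows "integral_affine_form g"
  using assms unfolding integral_affine_form_def by blast

text \<open>An integer combination of \<open>q\<close>, \<open>p1\<close>, \<open>p2\<close> is
  again an integer, so a form keeps the denominator \<open>q\<close> and only enlarges the error.
  One constant serves the whole finite family.\<close>

lemma integral_affine_forms_approx:
  assumes "finite F" "\<And>g. g \<in> F \<Longrightarrow> integral_affine_form g"
  obtains B :: real where "0 < B" and "\<And>g (q::nat) z (p1::int) (p2::int) \<epsilon>.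
    \<lbrakk>g \<in> F; \<bar>real q * z $ 1 - p1\<bar> < \<epsilon>; \<bar>real q * z $ 2 - p2\<bar> < \<epsilon>\<rbrakk> \<Longrightarrow> \<exists>P::int. \<bar>real q * g z - P\<bar> < B * \<epsilon>"
proof -
  obtain a b c :: "(real ^ 2 \<Rightarrow> real) \<Rightarrow> int"
    where g: "\<And>g z. g \<in> F \<Longrightarrow> g z = of_int (a g) + of_int (b g) * z $ 1 + of_int (c g) * z $ 2"
    using assms(2) unfolding integral_affine_form_def by metis
  define B' :: real where "B' = (\<Sum>g\<in>F. \<bar>of_int (b g)\<bar> + \<bar>of_int (c g)\<bar>)"
  have B': "0 \<le> B'" unfolding B'_def by (intro sum_nonneg) simp
  have "\<exists>P::int. \<bar>real q * g z - P\<bar> < (B' + 1) * \<epsilon>"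
    if gF: "g \<in> F" and p: "\<bar>real q * z $ 1 - of_int p1\<bar> < \<epsilon>" "\<bar>real q * z $ 2 - of_int p2\<bar> < \<epsilon>"
    for g and q :: nat and z :: "real ^ 2" and p1 p2 :: int and \<epsilon> :: real
  proof
    have e: "0 < \<epsilon>" using p by linarith
    have "\<bar>real q * g z - of_int (int q * a g + b g * p1 + c g * p2)\<bar> =
        \<bar>of_int (b g) * (real q * z $ 1 - of_int p1) + of_int (c g) * (real q * z $ 2 - of_int p2)\<bar>"
      by (simp add: g[OF gF] algebra_simps)
    also have "\<dots> \<le> \<bar>of_int (b g)\<bar> * \<bar>real q * z $ 1 - of_int p1\<bar> + \<bar>of_int (c g)\<bar> * \<bar>real q * z $ 2 - of_int p2\<bar>"
      unfolding abs_mult[symmetric] by (rule abs_triangle_ineq)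
    also have "\<dots> \<le> \<bar>of_int (b g)\<bar> * \<epsilon> + \<bar>of_int (c g)\<bar> * \<epsilon>"
      using p by (intro add_mono mult_left_mono) auto
    also have "\<dots> = (\<bar>of_int (b g)\<bar> + \<bar>of_int (c g)\<bar>) * \<epsilon>" by (simp add: algebra_simps)
    also have "\<dots> \<le> B' * \<epsilon>"
      unfolding B'_def using e assms(1) gF
      by (intro mult_right_mono member_le_sum[where f = "\<lambda>g. \<bar>of_int (b g)\<bar> + \<bar>of_int (c g)\<bar>"]) auto
    also have "\<dots> < (B' + 1) * \<epsilon>" using e by simp
    finally show "\<bar>real q * g z - of_int (int q * a g + b g * p1 + c g * p2)\<bar> < (B' + 1) * \<epsilon>" .
  qed
  with B' that[of "B' + 1"] show thesis by simp
qed

text \<open>Along the arc the three forms are in the ratio \<open>1 : x : x\<^sup>2\<close>, so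
  parameters of approximable points lie in \<open>parabola_approx\<close> of a rescaled function.
  This set is null, and the Lipschitz map \<open>\<gamma>\<close> carries it onto the arc.\<close>

lemma hausdorff_content_arc_eq_0:
  fixes \<gamma> :: "real \<Rightarrow> real ^ 2"
  assumes s: "1/2 < s" and \<psi>: "approximating_function \<psi>" "dyadic_summable s \<psi>"
    and \<gamma>: "L-lipschitz_on I \<gamma>" and I: "I \<subseteq> {-K..K}"
    and G: "integral_affine_form G0" "integral_affine_form G1" "integral_affine_form G2"
    and G0: "\<And>x. x \<in> I \<Longrightarrow> G0 (\<gamma> x) \<noteq> 0" "\<And>x. x \<in> I \<Longrightarrow> \<bar>G0 (\<gamma> x)\<bar> \<le> M"
    and G1: "\<And>x. x \<in> I \<Longrightarrow> G1 (\<gamma> x) = x * G0 (\<gamma> x)"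
    and G2: "\<And>x. x \<in> I \<Longrightarrow> G2 (\<gamma> x) = x\<^sup>2 * G0 (\<gamma> x)"
  shows "hausdorff_content s (\<gamma> ` I \<inter> simult_approx \<psi>) = 0"
proof -
  obtain B :: real where B: "0 < B" and P: "\<And>g (q::nat) z (p1::int) (p2::int) \<epsilon>.
      \<lbrakk>g \<in> {G0, G1, G2}; \<bar>real q * z $ 1 - p1\<bar> < \<epsilon>; \<bar>real q * z $ 2 - p2\<bar> < \<epsilon>\<rbrakk>
      \<Longrightarrow> \<exists>P::int. \<bar>real q * g z - P\<bar> < B * \<epsilon>"
    by (rule integral_affine_forms_approx[of "{G0, G1, G2}"]) (use G in auto)
  define K' where "K' = max 1 K"
  obtain d :: nat where d: "M + B * \<psi> 1 \<le> 2 ^ d"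
    using real_arch_pow[of 2 "M + B * \<psi> 1"] by (auto intro: less_imp_le)
  define \<phi> where "\<phi> t = (2 * K'\<^sup>2 * B) * \<psi> (t / 2 ^ d)" for t
  have c: "0 < 2 * K'\<^sup>2 * B" using B by (auto simp: K'_def)
  have \<phi>: "approximating_function \<phi>" "dyadic_summable s \<phi>"
    unfolding \<phi>_def using approximating_function_scale[OF \<psi>(1) c] dyadic_summable_scale[OF \<psi>(2) c \<psi>(1)] by auto
  have null: "hausdorff_content s (parabola_approx \<phi> \<inter> {-K'..K'}) = 0"
    using s approximating_functionD[OF \<phi>(1)] \<phi>(2)
    by (intro hausdorff_content_parabola_approx) (auto simp: dyadic_summable_def K'_def)
  have sub: "\<gamma> ` I \<inter> simult_approx \<psi> \<subseteq> \<gamma> ` (parabola_approx \<phi> \<inter> {-K'..K'} \<inter> I)"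
  proof clarify
    fix x assume x: "x \<in> I" and y: "\<gamma> x \<in> simult_approx \<psi>"
    have xK: "\<bar>x\<bar> \<le> K'" using I x by (force simp: K'_def)
    have "x \<in> parabola_approx \<phi>"
      unfolding \<phi>_def
    proof (rule mem_parabola_approxI[OF \<psi>(1) xK])
      show "\<bar>G0 (\<gamma> x)\<bar> + B * \<psi> 1 \<le> 2 ^ d" using G0(2)[OF x] d by linarith
      show "\<exists>q\<ge>n. 1 \<le> q \<and> (\<exists>(P0::int) (P1::int) (P2::int).
         \<bar>real q * G0 (\<gamma> x) - P0\<bar> < B * \<psi> (real q) \<and> \<bar>real q * (x * G0 (\<gamma> x)) - P1\<bar> < B * \<psi> (real q) \<and>
         \<bar>real q * (x\<^sup>2 * G0 (\<gamma> x)) - P2\<bar> < B * \<psi> (real q))" for n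
      proof -
        obtain q and p1 p2 :: int where q: "n \<le> q" "1 \<le> q"
          "\<bar>real q * \<gamma> x $ 1 - p1\<bar> < \<psi> (real q)" "\<bar>real q * \<gamma> x $ 2 - p2\<bar> < \<psi> (real q)"
          using y unfolding mem_simult_approx_iff by blast
        obtain P0 P1 P2 :: int where "\<bar>real q * G0 (\<gamma> x) - P0\<bar> < B * \<psi> (real q)"
          "\<bar>real q * G1 (\<gamma> x) - P1\<bar> < B * \<psi> (real q)" "\<bar>real q * G2 (\<gamma> x) - P2\<bar> < B * \<psi> (real q)"
          using P[of G0, OF _ q(3,4)] P[of G1, OF _ q(3,4)] P[of G2, OF _ q(3,4)] by auto
        then show ?thesis
          using q(1,2) unfolding G1[OF x] G2[OF x] by blast
      qed
    qed (use G0(1)[OF x] B in \<open>auto simp: K'_def\<close>)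
    then show "\<gamma> x \<in> \<gamma> ` (parabola_approx \<phi> \<inter> {-K'..K'} \<inter> I)"
      using x xK by (intro imageI) (auto simp: abs_le_iff)
  qed
  have "hausdorff_content s (parabola_approx \<phi> \<inter> {-K'..K'} \<inter> I) = 0"
    using hausdorff_content_mono[of "parabola_approx \<phi> \<inter> {-K'..K'} \<inter> I" "parabola_approx \<phi> \<inter> {-K'..K'}" s] null by auto
  then have "hausdorff_content s (\<gamma> ` (parabola_approx \<phi> \<inter> {-K'..K'} \<inter> I)) = 0"
    using s by (intro hausdorff_content_lipschitz_eq_0[OF lipschitz_on_subset[OF \<gamma>]]) auto
  then show ?thesis using hausdorff_content_mono[OF sub, of s] by simp
qed

section \<open>The three model conics\<close>

lemma lipschitz_on_vec2I:
  fixes \<gamma> :: "real \<Rightarrow> real ^ 2"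
  assumes "0 \<le> L" "\<And>x y. x \<in> I \<Longrightarrow> y \<in> I \<Longrightarrow> \<bar>\<gamma> x $ 1 - \<gamma> y $ 1\<bar> \<le> L * \<bar>x - y\<bar>"
    "\<And>x y. x \<in> I \<Longrightarrow> y \<in> I \<Longrightarrow> \<bar>\<gamma> x $ 2 - \<gamma> y $ 2\<bar> \<le> L * \<bar>x - y\<bar>"
  shows "(2 * L)-lipschitz_on I \<gamma>"
proof (rule lipschitz_onI)
  fix x y assume xy: "x \<in> I" "y \<in> I"
  have "dist (\<gamma> x) (\<gamma> y) \<le> (\<Sum>i\<in>UNIV. \<bar>(\<gamma> x - \<gamma> y) $ i\<bar>)"
    unfolding dist_norm by (rule norm_le_l1_cart)
  also have "\<dots> \<le> 2 * L * dist x y"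
    using assms(2,3)[OF xy] by (simp add: sum_2 dist_real_def)
  finally show "dist (\<gamma> x) (\<gamma> y) \<le> 2 * L * dist x y" .
qed (use assms in simp)

text \<open>For the parametrised circle, coordinate differences are \<open>2 * (x - y)\<close> times
  these left-hand sides without absolute values, over the common right-hand side. The bounds follow
  from sums of squares and give a Lipschitz constant independent of the arc.\<close>

lemma sum_and_product_bounds:
  fixes x y :: real
  shows "\<bar>x + y\<bar> \<le> (1 + x\<^sup>2) * (1 + y\<^sup>2)" "\<bar>1 - x * y\<bar> \<le> (1 + x\<^sup>2) * (1 + y\<^sup>2)"
proof -
  define p where "p = (1 + x\<^sup>2) * (1 + y\<^sup>2)"
  define m where "m = x\<^sup>2 * y\<^sup>2"
  have m: "0 \<le> m" by (simp add: m_def)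
  have "p - (x + y) = (x - 1/2)\<^sup>2 + (y - 1/2)\<^sup>2 + m + 1/2"
    "p + (x + y) = (x + 1/2)\<^sup>2 + (y + 1/2)\<^sup>2 + m + 1/2"
    by (simp_all add: p_def m_def algebra_simps power2_eq_square)
  then have "0 \<le> p - (x + y)" "0 \<le> p + (x + y)" using m by simp_all
  then show "\<bar>x + y\<bar> \<le> (1 + x\<^sup>2) * (1 + y\<^sup>2)" by (simp add: p_def[symmetric] abs_le_iff)
  define w where "w = 1 - x * y"
  have e: "2 * (p - w) = (x + y)\<^sup>2 + x\<^sup>2 + y\<^sup>2 + 2 * m"
    "2 * (p + w) = (x - y)\<^sup>2 + x\<^sup>2 + y\<^sup>2 + 2 * m + 4"
    by (simp_all add: p_def m_def w_def algebra_simps power2_eq_square)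
  have "0 \<le> 2 * (p - w)" "0 \<le> 2 * (p + w)" unfolding e using m by simp_all
  then have "0 \<le> p - w" "0 \<le> p + w" by (simp_all only: zero_le_mult_iff) simp_all
  then have "\<bar>w\<bar> \<le> p" by (simp add: abs_le_iff)
  then show "\<bar>1 - x * y\<bar> \<le> (1 + x\<^sup>2) * (1 + y\<^sup>2)" by (simp only: p_def w_def)
qed

context
  fixes s :: real and \<psi> :: "real \<Rightarrow> real"
  assumes s: "1/2 < s" and \<psi>: "approximating_function \<psi>" "dyadic_summable s \<psi>"
begin

text \<open>The forms 1, \<open>z $ 1\<close>, \<open>z $ 2\<close> have the required ratio at once;
  the curve is exhausted by bounded arcs because the Lipschitz constant grows with
  \<open>K\<close>.\<close>

lemma hausdorff_content_unit_parabola_eq_0: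
  "hausdorff_content s (unit_parabola \<inter> simult_approx \<psi>) = 0"
proof -
  define \<gamma> :: "real \<Rightarrow> real ^ 2" where "\<gamma> x = vector [x, x\<^sup>2]" for x
  have "hausdorff_content s (\<gamma> ` {-real K..real K} \<inter> simult_approx \<psi>) = 0" for K :: nat
  proof (rule hausdorff_content_arc_eq_0[OF s \<psi>, where M = 1 and K = "real K"])
    show "(2 * (2 * real K + 1))-lipschitz_on {-real K..real K} \<gamma>"
    proof (rule lipschitz_on_vec2I)
      fix x y assume xy: "x \<in> {-real K..real K}" "y \<in> {-real K..real K}"
      have "x\<^sup>2 - y\<^sup>2 = (x + y) * (x - y)" by (simp add: algebra_simps power2_eq_square)
      then have "\<bar>x\<^sup>2 - y\<^sup>2\<bar> = \<bar>x + y\<bar> * \<bar>x - y\<bar>" by (simp add: abs_mult)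
      also have "\<dots> \<le> (2 * real K + 1) * \<bar>x - y\<bar>" using xy by (intro mult_right_mono) auto
      finally show "\<bar>\<gamma> x $ 2 - \<gamma> y $ 2\<bar> \<le> (2 * real K + 1) * \<bar>x - y\<bar>" by (simp add: \<gamma>_def)
      show "\<bar>\<gamma> x $ 1 - \<gamma> y $ 1\<bar> \<le> (2 * real K + 1) * \<bar>x - y\<bar>" 
        using mult_right_mono[of 1 "2 * real K + 1" "\<bar>x - y\<bar>"] by (simp add: \<gamma>_def)
    qed simp
    show "integral_affine_form (\<lambda>z. 1)" by (rule integral_affine_formI[of _ 1 0 0]) simp
    show "integral_affine_form (\<lambda>z. z $ 1)" by (rule integral_affine_formI[of _ 0 1 0]) simp
    show "integral_affine_form (\<lambda>z. z $ 2)" by (rule integral_affine_formI[of _ 0 0 1]) simp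
  qed (auto simp: \<gamma>_def)
  then have "hausdorff_content s (\<Union>K::nat. \<gamma> ` {-real K..real K} \<inter> simult_approx \<psi>) = 0"
    by (intro hausdorff_content_countable_UN_eq_0)
  moreover have "unit_parabola \<subseteq> (\<Union>K::nat. \<gamma> ` {-real K..real K})"
  proof
    fix z :: "real ^ 2" assume "z \<in> unit_parabola"
    then have "z = \<gamma> (z $ 1)" by (simp add: unit_parabola_def \<gamma>_def vec_eq_iff forall_2)
    moreover obtain K :: nat where "\<bar>z $ 1\<bar> \<le> real K" using real_arch_simple by blast
    then have "z $ 1 \<in> {-real K..real K}" by auto
    ultimately show "z \<in> (\<Union>K::nat. \<gamma> ` {-real K..real K})" by blast
  qed
  then have "hausdorff_content s (unit_parabola \<inter> simult_approx \<psi>)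
      \<le> hausdorff_content s (\<Union>K::nat. \<gamma> ` {-real K..real K} \<inter> simult_approx \<psi>)"
    by (intro hausdorff_content_mono) blast
  ultimately show ?thesis by simp
qed

text \<open>Stereographic projection from \<open>(1, 0)\<close>.\<close>

lemma hausdorff_content_unit_circle_eq_0:
  "hausdorff_content s (unit_circle \<inter> simult_approx \<psi>) = 0"
proof -
  define \<gamma> :: "real \<Rightarrow> real ^ 2" where "\<gamma> x = vector [1 - 2 / (1 + x\<^sup>2), 2 * x / (1 + x\<^sup>2)]" for x
  have nz: "1 + x\<^sup>2 \<noteq> 0" "0 < 1 + x\<^sup>2" for x :: real
    using zero_le_power2[of x] by linarith+
  have arc: "hausdorff_content s (\<gamma> ` {-real K..real K} \<inter> simult_approx \<psi>) = 0" for K :: nat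
  proof (rule hausdorff_content_arc_eq_0[OF s \<psi>, where M = 2 and K = "real K"])
    show "(2 * 2)-lipschitz_on {-real K..real K} \<gamma>"
    proof (rule lipschitz_on_vec2I)
      fix x y :: real
      define p where "p = (1 + x\<^sup>2) * (1 + y\<^sup>2)"
      have p: "0 < p" using nz by (simp add: p_def)
      have bnd: "\<bar>2 * ((x - y) * (t / p))\<bar> \<le> 2 * \<bar>x - y\<bar>" if "\<bar>t\<bar> \<le> p" for t
      proof -
        have "\<bar>t / p\<bar> \<le> 1" using that p by simp
        then have "\<bar>x - y\<bar> * \<bar>t / p\<bar> \<le> \<bar>x - y\<bar> * 1" by (intro mult_left_mono) auto
        then show ?thesis by (simp only: abs_mult abs_numeral)
      qed
      have "\<gamma> x $ 1 - \<gamma> y $ 1 = 2 / (1 + y\<^sup>2) - 2 / (1 + x\<^sup>2)" by (simp add: \<gamma>_def)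
      also have "\<dots> = (2 * (1 + x\<^sup>2) - 2 * (1 + y\<^sup>2)) / p"
        using nz(1)[of x] nz(1)[of y] by (subst diff_frac_eq) (simp_all add: p_def mult.commute)
      also have "2 * (1 + x\<^sup>2) - 2 * (1 + y\<^sup>2) = 2 * ((x - y) * (x + y))"
        by (simp add: algebra_simps power2_eq_square)
      finally show "\<bar>\<gamma> x $ 1 - \<gamma> y $ 1\<bar> \<le> 2 * \<bar>x - y\<bar>"
        using bnd[of "x + y"] sum_and_product_bounds(1)[of x y] by (simp add: p_def)
      have "\<gamma> x $ 2 - \<gamma> y $ 2 = 2 * x / (1 + x\<^sup>2) - 2 * y / (1 + y\<^sup>2)" by (simp add: \<gamma>_def)
      also have "\<dots> = (2 * x * (1 + y\<^sup>2) - 2 * y * (1 + x\<^sup>2)) / p"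
        using nz(1)[of x] nz(1)[of y] by (subst diff_frac_eq) (simp_all add: p_def)
      also have "2 * x * (1 + y\<^sup>2) - 2 * y * (1 + x\<^sup>2) = 2 * ((x - y) * (1 - x * y))"
        by (simp add: algebra_simps power2_eq_square)
      finally show "\<bar>\<gamma> x $ 2 - \<gamma> y $ 2\<bar> \<le> 2 * \<bar>x - y\<bar>"
        using bnd[of "1 - x * y"] sum_and_product_bounds(2)[of x y] by (simp add: p_def)
    qed simp
    \<comment> \<open>On the circle \<open>(z $ 2)\<^sup>2 = (1 - z $ 1) * (1 + z $ 1)\<close>, so
      these three forms are in geometric progression with ratio \<open>x\<close>.\<close>
    show "integral_affine_form (\<lambda>z. 1 - z $ 1)" by (rule integral_affine_formI[of _ 1 "-1" 0]) simp
    show "integral_affine_form (\<lambda>z. z $ 2)" by (rule integral_affine_formI[of _ 0 0 1]) simp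
    show "integral_affine_form (\<lambda>z. 1 + z $ 1)" by (rule integral_affine_formI[of _ 1 1 0]) simp
    fix x :: real
    have g: "1 - \<gamma> x $ 1 = 2 / (1 + x\<^sup>2)" by (simp add: \<gamma>_def)
    show "1 - \<gamma> x $ 1 \<noteq> 0" "\<bar>1 - \<gamma> x $ 1\<bar> \<le> 2"
      unfolding g using nz[of x] by (simp_all add: divide_le_eq)
    show "\<gamma> x $ 2 = x * (1 - \<gamma> x $ 1)" by (simp add: \<gamma>_def)
    have "(2 * (1 + x\<^sup>2) - 2) / (1 + x\<^sup>2) = 2 * (1 + x\<^sup>2) / (1 + x\<^sup>2) - 2 / (1 + x\<^sup>2)"
      by (rule diff_divide_distrib)
    also have "2 * (1 + x\<^sup>2) / (1 + x\<^sup>2) = 2" using nz(1) by (rule nonzero_mult_div_cancel_right)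
    finally have "2 - 2 / (1 + x\<^sup>2) = x\<^sup>2 * (2 / (1 + x\<^sup>2))" by (simp add: algebra_simps)
    then show "1 + \<gamma> x $ 1 = x\<^sup>2 * (1 - \<gamma> x $ 1)" by (simp add: \<gamma>_def)
  qed auto
  \<comment> \<open>The centre of projection is the one point that \<open>\<gamma>\<close>
    misses.\<close>
  define z0 :: "real ^ 2" where "z0 = vector [1, 0]"
  have "hausdorff_content s (\<Union>K::nat. \<gamma> ` {-real K..real K} \<inter> simult_approx \<psi>) = 0"
    by (intro hausdorff_content_countable_UN_eq_0 arc)
  moreover have "hausdorff_content s {z0} = 0"
    using hausdorff_content_le_diameter[of "{z0}" s] by simp
  ultimately have "hausdorff_content s ((\<Union>K::nat. \<gamma> ` {-real K..real K} \<inter> simult_approx \<psi>) \<union> {z0}) = 0"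
    by (rule hausdorff_content_Un_eq_0)
  moreover have "z \<in> (\<Union>K::nat. \<gamma> ` {-real K..real K})" if z: "z \<in> unit_circle" "z \<noteq> z0" for z
  proof -
    define x where "x = z $ 2 / (1 - z $ 1)"
    have eq: "(z $ 2)\<^sup>2 = (1 - z $ 1) * (1 + z $ 1)"
      using z by (simp add: unit_circle_def algebra_simps power2_eq_square)
    have n1: "1 - z $ 1 \<noteq> 0"
    proof
      assume "1 - z $ 1 = 0"
      then show False using eq z(2) by (simp add: z0_def vec_eq_iff forall_2)
    qed
    have xz: "x * (1 - z $ 1) = z $ 2" using n1 by (simp add: x_def)
    have "(x\<^sup>2 * (1 - z $ 1)) * (1 - z $ 1) = (x * (1 - z $ 1))\<^sup>2" by (simp only: power2_eq_square mult_ac)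
    also have "\<dots> = (1 + z $ 1) * (1 - z $ 1)" unfolding xz eq by (rule mult.commute)
    finally have "x\<^sup>2 * (1 - z $ 1) = 1 + z $ 1" using n1 mult_right_cancel by blast
    then have "(1 + x\<^sup>2) * (1 - z $ 1) = 2" by (simp add: distrib_right)
    then have x2: "1 + x\<^sup>2 = 2 / (1 - z $ 1)" by (simp only: nonzero_eq_divide_eq[OF n1])
    have "\<gamma> x $ 1 = 1 - 2 / (1 + x\<^sup>2)" "\<gamma> x $ 2 = 2 * x / (1 + x\<^sup>2)" by (simp_all add: \<gamma>_def)
    then have "\<gamma> x $ 1 = z $ 1" "\<gamma> x $ 2 = x * (1 - z $ 1)" unfolding x2 by (simp_all add: diff_divide_distrib)
    then have "z = \<gamma> x" by (simp add: xz vec_eq_iff forall_2)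
    moreover obtain K :: nat where "\<bar>x\<bar> \<le> real K" using real_arch_simple by blast
    then have "x \<in> {-real K..real K}" by auto
    ultimately show ?thesis by blast
  qed
  then have "hausdorff_content s (unit_circle \<inter> simult_approx \<psi>)
      \<le> hausdorff_content s ((\<Union>K::nat. \<gamma> ` {-real K..real K} \<inter> simult_approx \<psi>) \<union> {z0})"
    by (intro hausdorff_content_mono) blast
  ultimately show ?thesis by simp
qed

text \<open>With \<open>x = z $ 1 + z $ 2\<close> the equation says
  \<open>z $ 1 - z $ 2 = 1 / x\<close>, so \<open>z $ 1 - z $ 2\<close>, 1,
  \<open>z $ 1 + z $ 2\<close> are in geometric progression with ratio \<open>x\<close>.\<close>

lemma hausdorff_content_unit_hyperbola_eq_0:
  "hausdorff_content s (unit_hyperbola \<inter> simult_approx \<psi>) = 0"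
proof -
  define \<gamma> :: "real \<Rightarrow> real ^ 2" where "\<gamma> x = vector [(x + 1 / x) / 2, (x - 1 / x) / 2]" for x
  \<comment> \<open>Both signs of \<open>x\<close>, hence both branches, are included; the bound on
    \<open>1 / x\<close> keeps away from the pole. \<open>Suc K\<close> makes the bound at least
    1.\<close>
  define I where "I K = {x. \<bar>x\<bar> \<le> real (Suc K) \<and> \<bar>1 / x\<bar> \<le> real (Suc K) \<and> x \<noteq> 0}" for K :: nat
  have "hausdorff_content s (\<gamma> ` I K \<inter> simult_approx \<psi>) = 0" for K :: nat
  proof (rule hausdorff_content_arc_eq_0[OF s \<psi>, where M = "real (Suc K)" and K = "real (Suc K)"])
    define k where "k = real (Suc K)"
    have k: "1 \<le> k" by (simp add: k_def)
    show "(2 * k\<^sup>2)-lipschitz_on (I K) \<gamma>"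
    proof (rule lipschitz_on_vec2I)
      fix x y assume xy: "x \<in> I K" "y \<in> I K"
      have "1 / x - 1 / y = (1 / x) * (1 / y) * (y - x)" using xy by (simp add: I_def field_simps)
      then have "\<bar>1 / x - 1 / y\<bar> = \<bar>1 / x\<bar> * \<bar>1 / y\<bar> * \<bar>x - y\<bar>" by (simp only: abs_mult abs_minus_commute)
      also have "\<dots> \<le> k * k * \<bar>x - y\<bar>"
        using xy k by (intro mult_right_mono mult_mono) (auto simp: I_def k_def)
      finally have 1: "\<bar>1 / x - 1 / y\<bar> \<le> k\<^sup>2 * \<bar>x - y\<bar>" by (simp add: power2_eq_square)
      have 2: "\<bar>x - y\<bar> \<le> k\<^sup>2 * \<bar>x - y\<bar>" using mult_right_mono[of 1 "k\<^sup>2" "\<bar>x - y\<bar>"] k by simp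
      have mean: "\<bar>(u + v) / 2\<bar> \<le> t \<and> \<bar>(u - v) / 2\<bar> \<le> t" if "\<bar>u\<bar> \<le> t" "\<bar>v\<bar> \<le> t" for u v t :: real
        using that by (simp add: abs_le_iff)
      have 3: "\<gamma> x $ 1 - \<gamma> y $ 1 = ((x - y) + (1 / x - 1 / y)) / 2"
        "\<gamma> x $ 2 - \<gamma> y $ 2 = ((x - y) - (1 / x - 1 / y)) / 2"
        by (simp_all add: \<gamma>_def algebra_simps add_divide_distrib diff_divide_distrib)
      show "\<bar>\<gamma> x $ 1 - \<gamma> y $ 1\<bar> \<le> k\<^sup>2 * \<bar>x - y\<bar>" unfolding 3 using mean[OF 2 1] by simp
      show "\<bar>\<gamma> x $ 2 - \<gamma> y $ 2\<bar> \<le> k\<^sup>2 * \<bar>x - y\<bar>" unfolding 3 using mean[OF 2 1] by simp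
    qed simp
    show "integral_affine_form (\<lambda>z. z $ 1 - z $ 2)" by (rule integral_affine_formI[of _ 0 1 "-1"]) simp
    show "integral_affine_form (\<lambda>z. 1)" by (rule integral_affine_formI[of _ 1 0 0]) simp
    show "integral_affine_form (\<lambda>z. z $ 1 + z $ 2)" by (rule integral_affine_formI[of _ 0 1 1]) simp
    fix x assume x: "x \<in> I K"
    have "\<gamma> x $ 1 - \<gamma> x $ 2 = 1 / x" "\<gamma> x $ 1 + \<gamma> x $ 2 = x"
      by (simp_all add: \<gamma>_def algebra_simps add_divide_distrib diff_divide_distrib)
    with x show "\<gamma> x $ 1 - \<gamma> x $ 2 \<noteq> 0" "\<bar>\<gamma> x $ 1 - \<gamma> x $ 2\<bar> \<le> real (Suc K)"
      "1 = x * (\<gamma> x $ 1 - \<gamma> x $ 2)" "\<gamma> x $ 1 + \<gamma> x $ 2 = x\<^sup>2 * (\<gamma> x $ 1 - \<gamma> x $ 2)"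
      by (auto simp: I_def power2_eq_square)
  qed (auto simp: I_def)
  then have "hausdorff_content s (\<Union>K::nat. \<gamma> ` I K \<inter> simult_approx \<psi>) = 0"
    by (intro hausdorff_content_countable_UN_eq_0)
  moreover have "unit_hyperbola \<subseteq> (\<Union>K::nat. \<gamma> ` I K)"
  proof
    fix z :: "real ^ 2" assume z: "z \<in> unit_hyperbola"
    define x where "x = z $ 1 + z $ 2"
    have eq: "x * (z $ 1 - z $ 2) = 1"
      using z by (simp add: x_def unit_hyperbola_def algebra_simps power2_eq_square)
    then have x0: "x \<noteq> 0" by auto
    then have "1 / x = z $ 1 - z $ 2" using eq by (simp add: field_simps)
    then have "z = \<gamma> x" by (simp add: \<gamma>_def vec_eq_iff forall_2) (simp add: x_def)
    moreover obtain K :: nat where "max \<bar>x\<bar> \<bar>1 / x\<bar> \<le> real K" using real_arch_simple by blast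
    then have "x \<in> I K" using x0 by (auto simp: I_def)
    ultimately show "z \<in> (\<Union>K::nat. \<gamma> ` I K)" by blast
  qed
  then have "hausdorff_content s (unit_hyperbola \<inter> simult_approx \<psi>)
      \<le> hausdorff_content s (\<Union>K::nat. \<gamma> ` I K \<inter> simult_approx \<psi>)"
    by (intro hausdorff_content_mono) blast
  ultimately show ?thesis by simp
qed

end

section \<open>Rational affine maps\<close>

lemma rationals_common_denominator:
  assumes "finite S" "S \<subseteq> (\<rat> :: real set)"
  obtains m :: nat where "0 < m" "\<And>x. x \<in> S \<Longrightarrow> real m * x \<in> \<int>"
proof -
  have "\<exists>m::nat. 0 < m \<and> (\<forall>x\<in>S. real m * x \<in> \<int>)"
    using assms
  proof (induction S)
    case (insert x S)
    then obtain m :: nat where m: "0 < m" "\<forall>x\<in>S. real m * x \<in> \<int>" by auto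
    obtain a b :: int where ab: "0 < b" "x = of_int a / of_int b"
      using insert.prems by (auto elim!: Rats_cases')
    have "real (m * nat b) * y \<in> \<int>" if "y \<in> insert x S" for y
    proof (cases "y = x")
      case True
      then have "real (m * nat b) * y = of_int (int m * a)" using ab by simp
      then show ?thesis by (metis Ints_of_int)
    next
      case False
      with that have "y \<in> S" by simp
      then have "real m * y \<in> \<int>" using m(2) by simp
      then have "of_int b * (real m * y) \<in> \<int>" by (rule Ints_mult[OF Ints_of_int])
      moreover have "real (m * nat b) * y = of_int b * (real m * y)" using ab(1) by simp
      ultimately show ?thesis by (simp only:)
    qed
    then show ?case using m ab by (intro exI[of _ "m * nat b"]) auto
  qed auto
  then show thesis using that by blast
qed

text \<open>The coordinates of the inverse map, cleared of denominators; this is what lets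
  approximations of \<open>T z\<close> be turned into approximations of \<open>z\<close>.\<close>

lemma rational_affine_inverse_forms:
  assumes "rational_affine T"
  obtains D :: nat and g1 g2 where "0 < D" "integral_affine_form g1" "integral_affine_form g2"
    "\<And>z. g1 (T z) = real D * z $ 1" "\<And>z. g2 (T z) = real D * z $ 2"
proof -
  obtain A :: "real ^ 2 ^ 2" and b :: "real ^ 2" where
    rat: "\<And>i j. A $ i $ j \<in> \<rat>" "\<And>i. b $ i \<in> \<rat>" and inv: "invertible A" and T: "T = (\<lambda>x. A *v x + b)"
    using assms unfolding rational_affine_def by blast
  obtain m :: nat where m: "0 < m"
    "\<And>x. x \<in> {A $ 1 $ 1, A $ 1 $ 2, A $ 2 $ 1, A $ 2 $ 2, b $ 1, b $ 2} \<Longrightarrow> real m * x \<in> \<int>"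
    by (rule rationals_common_denominator[of "{A $ 1 $ 1, A $ 1 $ 2, A $ 2 $ 1, A $ 2 $ 2, b $ 1, b $ 2}"]) (use rat in auto)
  obtain a11 where a11: "real m * A $ 1 $ 1 = of_int a11" using m(2)[of "A $ 1 $ 1"] by (auto elim: Ints_cases)
  obtain a12 where a12: "real m * A $ 1 $ 2 = of_int a12" using m(2)[of "A $ 1 $ 2"] by (auto elim: Ints_cases)
  obtain a21 where a21: "real m * A $ 2 $ 1 = of_int a21" using m(2)[of "A $ 2 $ 1"] by (auto elim: Ints_cases)
  obtain a22 where a22: "real m * A $ 2 $ 2 = of_int a22" using m(2)[of "A $ 2 $ 2"] by (auto elim: Ints_cases)
  obtain b1 where b1: "real m * b $ 1 = of_int b1" using m(2)[of "b $ 1"] by (auto elim: Ints_cases)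
  obtain b2 where b2: "real m * b $ 2 = of_int b2" using m(2)[of "b $ 2"] by (auto elim: Ints_cases)
  define \<Delta> where "\<Delta> = a11 * a22 - a12 * a21"
  have "of_int \<Delta> = (real m)\<^sup>2 * det A"
    by (simp add: \<Delta>_def det_2 a11[symmetric] a12[symmetric] a21[symmetric] a22[symmetric] algebra_simps power2_eq_square)
  moreover have "det A \<noteq> 0" using inv by (simp add: invertible_det_nz)
  ultimately have "real_of_int \<Delta> \<noteq> 0" using m(1) by simp
  then have \<Delta>: "\<Delta> \<noteq> 0" by simp
  have Tz: "real m * T z $ 1 = of_int a11 * z $ 1 + of_int a12 * z $ 2 + of_int b1"
    "real m * T z $ 2 = of_int a21 * z $ 1 + of_int a22 * z $ 2 + of_int b2" for z
    by (simp_all add: T matrix_vector_mult_def sum_2 a11[symmetric] a12[symmetric] a21[symmetric] a22[symmetric]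
        b1[symmetric] b2[symmetric] algebra_simps)
  \<comment> \<open>Cramer's rule, with \<open>sgn \<Delta>\<close> making the common denominator positive.\<close>
  define g1 where "g1 y = of_int (sgn \<Delta>) * (of_int a22 * (real m * y $ 1 - of_int b1) - of_int a12 * (real m * y $ 2 - of_int b2))" for y :: "real ^ 2"
  define g2 where "g2 y = of_int (sgn \<Delta>) * (of_int a11 * (real m * y $ 2 - of_int b2) - of_int a21 * (real m * y $ 1 - of_int b1))" for y :: "real ^ 2"
  have D: "real (nat \<bar>\<Delta>\<bar>) = of_int (sgn \<Delta>) * of_int \<Delta>" by (simp add: sgn_if)
  show thesis
  proof (rule that[of "nat \<bar>\<Delta>\<bar>" g1 g2])
    show "integral_affine_form g1"
      by (rule integral_affine_formI[of _ "sgn \<Delta> * (a12 * b2 - a22 * b1)" "sgn \<Delta> * a22 * int m" "- sgn \<Delta> * a12 * int m"])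
        (simp add: g1_def algebra_simps)
    show "integral_affine_form g2"
      by (rule integral_affine_formI[of _ "sgn \<Delta> * (a21 * b1 - a11 * b2)" "- sgn \<Delta> * a21 * int m" "sgn \<Delta> * a11 * int m"])
        (simp add: g2_def algebra_simps)
    show "g1 (T z) = real (nat \<bar>\<Delta>\<bar>) * z $ 1" for z
    proof -
      have "g1 (T z) = of_int (sgn \<Delta>) * (of_int \<Delta> * z $ 1)"
        unfolding g1_def Tz by (rule arg_cong[where f = "(*) _"]) (simp add: \<Delta>_def algebra_simps)
      then show ?thesis by (simp only: D mult.assoc)
    qed
    show "g2 (T z) = real (nat \<bar>\<Delta>\<bar>) * z $ 2" for z
    proof -
      have "g2 (T z) = of_int (sgn \<Delta>) * (of_int \<Delta> * z $ 2)"
        unfolding g2_def Tz by (rule arg_cong[where f = "(*) _"]) (simp add: \<Delta>_def algebra_simps)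
      then show ?thesis by (simp only: D mult.assoc)
    qed
  qed (use \<Delta> in simp)
qed

text \<open>A denominator \<open>q\<close> for \<open>T z\<close> becomes \<open>q * D\<close> for
  \<open>z\<close>. Since \<open>D \<le> 2 ^ d\<close>, monotonicity bounds \<psi> at
  \<open>q\<close> by \<psi> at \<open>q * D / 2 ^ d\<close>.\<close>

lemma simult_approx_affine_preimage:
  assumes "rational_affine T" and \<psi>: "approximating_function \<psi>"
  obtains c d where "0 < c" "\<And>z. T z \<in> simult_approx \<psi> \<Longrightarrow> z \<in> simult_approx (\<lambda>t. c * \<psi> (t / 2 ^ d))"
proof -
  obtain D :: nat and g1 g2 where D: "0 < D" and G: "integral_affine_form g1" "integral_affine_form g2"
    and g: "\<And>z. g1 (T z) = real D * z $ 1" "\<And>z. g2 (T z) = real D * z $ 2"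
    using rational_affine_inverse_forms[OF assms(1)] by metis
  obtain c :: real where c: "0 < c" and approx: "\<And>g (q::nat) z (p1::int) (p2::int) \<epsilon>.
      \<lbrakk>g \<in> {g1, g2}; \<bar>real q * z $ 1 - p1\<bar> < \<epsilon>; \<bar>real q * z $ 2 - p2\<bar> < \<epsilon>\<rbrakk>
      \<Longrightarrow> \<exists>P::int. \<bar>real q * g z - P\<bar> < c * \<epsilon>"
    by (rule integral_affine_forms_approx[of "{g1, g2}"]) (use G in auto)
  obtain d :: nat where d: "real D \<le> 2 ^ d"
    using real_arch_pow[of 2 "real D"] by (auto intro: less_imp_le)
  have "z \<in> simult_approx (\<lambda>t. c * \<psi> (t / 2 ^ d))" if z: "T z \<in> simult_approx \<psi>" for z
    unfolding mem_simult_approx_iff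
  proof
    fix n :: nat
    obtain q and p1 p2 :: int where q: "n \<le> q" "1 \<le> q"
      "\<bar>real q * T z $ 1 - p1\<bar> < \<psi> (real q)" "\<bar>real q * T z $ 2 - p2\<bar> < \<psi> (real q)"
      using z unfolding mem_simult_approx_iff by blast
    obtain P1 P2 :: int where P: "\<bar>real q * g1 (T z) - P1\<bar> < c * \<psi> (real q)" "\<bar>real q * g2 (T z) - P2\<bar> < c * \<psi> (real q)"
      using approx[OF _ q(3,4)] by blast
    have "real q * real D \<le> real q * 2 ^ d" using d by (intro mult_left_mono) auto
    then have "real (q * D) / 2 ^ d \<le> real q" by (simp add: divide_le_eq)
    moreover have "0 < real (q * D) / 2 ^ d" using q D by simp
    ultimately have "\<psi> (real q) \<le> \<psi> (real (q * D) / 2 ^ d)" by (intro approximating_functionD(2)[OF \<psi>])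
    then have "c * \<psi> (real q) \<le> c * \<psi> (real (q * D) / 2 ^ d)" using c by simp
    with P have "\<bar>real (q * D) * z $ 1 - P1\<bar> < c * \<psi> (real (q * D) / 2 ^ d)"
      "\<bar>real (q * D) * z $ 2 - P2\<bar> < c * \<psi> (real (q * D) / 2 ^ d)"
      unfolding g by (simp_all add: mult.assoc)
    moreover have "q \<le> q * D" using D by simp
    then have "n \<le> q * D" "1 \<le> q * D" using q by linarith+
    ultimately show "\<exists>q\<ge>n. 1 \<le> q \<and> (\<exists>p1 p2. \<bar>real q * z $ 1 - real_of_int p1\<bar> < c * \<psi> (real q / 2 ^ d) \<and>
        \<bar>real q * z $ 2 - real_of_int p2\<bar> < c * \<psi> (real q / 2 ^ d))" by blast
  qed
  with c that show thesis by blast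
qed

lemma rational_affine_lipschitz:
  assumes "rational_affine T"
  obtains L where "\<And>X. L-lipschitz_on X T"
proof -
  obtain A :: "real ^ 2 ^ 2" and b :: "real ^ 2" where T: "T = (\<lambda>x. A *v x + b)"
    using assms unfolding rational_affine_def by blast
  interpret bounded_linear "(*v) A" by (rule matrix_vector_mul_bounded_linear)
  obtain L where "0 \<le> L" "\<And>x. norm (A *v x) \<le> norm x * L" using nonneg_bounded by blast
  then have "L-lipschitz_on X T" for X
    by (intro lipschitz_onI) (auto simp: T dist_norm mult.commute simp flip: diff)
  then show thesis by (rule that)
qed

text \<open>The quadric is pulled back to its model conic at the cost of a rescaled function whose
  condensed series still converges; the Lipschitz map \<open>T\<close> sends the resulting null set
  back.\<close>

theorem theorem5:
  fixes s :: real and \<psi> :: "real \<Rightarrow> real" and Q :: "(real ^ 2) set"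
  assumes "s \<in> {1/2<..<1}"
    and "approximating_function \<psi>"
    and "nondegenerate_rational_quadric Q"
    and "summable (\<lambda>n::nat. real (Suc n) powr (1 - s) * \<psi> (real (Suc n)) powr (s + 1))"
  shows "hausdorff_measure s (Q \<inter> simult_approx \<psi>) = 0"
proof -
  have s: "1/2 < s" "s < 1" "0 < s" using assms(1) by auto
  obtain T C where T: "rational_affine T" and C: "C \<in> {unit_circle, unit_hyperbola, unit_parabola}" and Q: "Q = T ` C"
    using assms(3) unfolding nondegenerate_rational_quadric_def by blast
  obtain c d where cd: "0 < c" "\<And>z. T z \<in> simult_approx \<psi> \<Longrightarrow> z \<in> simult_approx (\<lambda>t. c * \<psi> (t / 2 ^ d))"
    using simult_approx_affine_preimage[OF T assms(2)] by metis
  define \<phi> where "\<phi> t = c * \<psi> (t / 2 ^ d)" for t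
  have "dyadic_summable s \<psi>" using s assms by (intro dyadic_summableI) auto
  then have \<phi>: "approximating_function \<phi>" "dyadic_summable s \<phi>"
    unfolding \<phi>_def using cd(1) assms(2) by (auto intro: approximating_function_scale dyadic_summable_scale)
  obtain L where L: "\<And>X. L-lipschitz_on X T" using rational_affine_lipschitz[OF T] by blast
  have "hausdorff_content s (C \<inter> simult_approx \<phi>) = 0"
    using C hausdorff_content_unit_circle_eq_0[OF s(1) \<phi>] hausdorff_content_unit_hyperbola_eq_0[OF s(1) \<phi>]
      hausdorff_content_unit_parabola_eq_0[OF s(1) \<phi>] by auto
  then have "hausdorff_content s (T ` (C \<inter> simult_approx \<phi>)) = 0"
    using s by (intro hausdorff_content_lipschitz_eq_0[OF L])
  moreover have "Q \<inter> simult_approx \<psi> \<subseteq> T ` (C \<inter> simult_approx \<phi>)"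
    using cd(2) unfolding Q \<phi>_def by blast
  then have "hausdorff_content s (Q \<inter> simult_approx \<psi>) \<le> hausdorff_content s (T ` (C \<inter> simult_approx \<phi>))"
    by (rule hausdorff_content_mono)
  ultimately show ?thesis using s by (intro hausdorff_measure_eq_0) auto
qed

end
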